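(* Let $D\subset\mathbb R^d$ be compact, let $K\colon D\times D\to\mathbb C$ be a continuous Hermitian positive definite kernel with $\sup_{x\in D}\sqrt{K(x,x)}<\infty$ whose reproducing kernel Hilbert space $H(K)$ is infinite dimensional, and let $\varrho_D$ be a finite Borel measure on $D$ with full support. Suppose that (i) $N_{K,\varrho_D}(k)=\mathcal O(k^u)$, and (ii) there exist $p>1/2$ and $C_2>0$ such that $\sigma_j\le C_2j^{-p}$ for $j=1,2,\dots$, where $u$ and $p$ are optimal, i.e. $u=\inf\{u':N_{K,\varrho_D}(k)=\mathcal O(k^{u'})\}$ and $p=\sup\{p':\ \exists C>0\ \forall j\ \ \sigma_j\le Cj^{-p'}\}$, and suppose $2p>u$. Then $q^{\rm std}_\infty\ge p-u/2$. In the case $u=1$ (or if (i) is replaced by the condition (i') that there exists $C_1>0$ with $\|\eta_j\|_{\ell_\infty(D)}\le C_1$ for all $j=1,2,\dots$) one has $$q^{\rm std}_\infty=q^{\rm lin}_\infty=p-\tfrac12 .$$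
   Context: $\|f\|_{\ell_\infty(D)}=\sup_{x\in D}|f(x)|$. For $\mathrm{Id}\colon H(K)\to\ell_\infty(D)$ define approximation numbers $a_n(\mathrm{Id}):=\inf\{\sup_{\|f\|_{H(K)}\le1}\|f-Af\|_{\ell_\infty(D)}:\ A\colon H(K)\to\ell_\infty(D)\text{ linear continuous},\ \operatorname{rank}A<n\}$; sampling numbers $g_n(\mathrm{Id}):=\inf_{x^1,\dots,x^n\in D}\inf_R\sup_{\|f\|_{H(K)}\le1}\|f-R(f(x^1),\dots,f(x^n))\|_{\ell_\infty(D)}$, where $R$ runs over linear maps $\mathbb C^n\to\ell_\infty(D)$. Optimal orders of convergence: $$q^{\rm lin}_\infty:=\sup\{q\ge0:\lim_{n\to\infty}n^qa_n(\mathrm{Id})=0\},\qquad q^{\rm std}_\infty:=\sup\{q\ge0:\lim_{n\to\infty}n^qg_n(\mathrm{Id})=0\}.$$ Spectral data: the embedding $J\colon H(K)\to L_2(D,\varrho_D)$ is compact. Let $\lambda_1\ge\lambda_2\ge\dots>0$ be the eigenvalues of $J^*J$, $\sigma_k=\sqrt{\lambda_k}$ the singular numbers of $J$, $(e_k^* )_{k\ge1}$ a corresponding $H(K)$-orthonormal system of eigenfunctions, and $\eta_k:=\sigma_k^{-1}e_k^*$ (pointwise defined), which is orthonormal in $L_2(D,\varrho_D)$. Then $N_{K,\varrho_D}(m):=\sup_{x\in D}\sum_{k=1}^{m-1}|\eta_k(x)|^2$. *)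

theory Defs
  imports "HOL-Analysis.Analysis" "HOL-Library.Function_Algebras" "HOL-Library.Landau_Symbols"
begin

section \<open>Complex vector spaces of functions\<close>

text \<open>
  A complex function on a set \<open>D\<close> is represented by the total function that vanishes outside
  \<open>D\<close>, so that equality of such functions is equality on \<open>D\<close>.  Likewise \<open>\<complex>\<^sup>n\<close> consists
  of the sequences that vanish from index \<open>n\<close> on.
\<close>

definition cscale :: "complex \<Rightarrow> ('a \<Rightarrow> complex) \<Rightarrow> 'a \<Rightarrow> complex" where
  "cscale c f = (\<lambda>x. c * f x)"

global_interpretation cfun: vector_space "cscale :: complex \<Rightarrow> ('a \<Rightarrow> complex) \<Rightarrow> 'a \<Rightarrow> complex"
  by unfold_locales (auto simp: cscale_def fun_eq_iff algebra_simps)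

definition linear_map_on ::
    "('a \<Rightarrow> complex) set \<Rightarrow> (('a \<Rightarrow> complex) \<Rightarrow> ('b \<Rightarrow> complex)) \<Rightarrow> bool" where
  "linear_map_on V A \<longleftrightarrow>
     (\<forall>f\<in>V. \<forall>g\<in>V. A (f + g) = A f + A g) \<and> (\<forall>c. \<forall>f\<in>V. A (cscale c f) = cscale c (A f))"

text \<open>The range of \<open>A\<close> on \<open>V\<close> has a basis with fewer than \<open>n\<close> elements.  The library's
  \<open>dim\<close> is not used because it is \<open>0\<close> for infinite-dimensional spaces.\<close>

definition rank_less ::
    "('a \<Rightarrow> complex) set \<Rightarrow> (('a \<Rightarrow> complex) \<Rightarrow> ('b \<Rightarrow> complex)) \<Rightarrow> nat \<Rightarrow> bool" where
  "rank_less V A n \<longleftrightarrow>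
     (\<exists>B. finite B \<and> card B < n \<and> \<not> cfun.dependent B \<and> cfun.span B = A ` V)"

definition infinite_dimensional :: "('a \<Rightarrow> complex) set \<Rightarrow> bool" where
  "infinite_dimensional V \<longleftrightarrow> \<not> (\<exists>B. finite B \<and> V \<subseteq> cfun.span B)"

definition complex_tuples :: "nat \<Rightarrow> (nat \<Rightarrow> complex) set" where
  "complex_tuples n = {c. \<forall>i\<ge>n. c i = 0}"

definition sup_norm :: "'a set \<Rightarrow> ('a \<Rightarrow> complex) \<Rightarrow> ennreal" where
  "sup_norm D f = (SUP x\<in>D. ennreal (cmod (f x)))"

definition l_infinity :: "'a set \<Rightarrow> ('a \<Rightarrow> complex) set" where
  "l_infinity D = {f. (\<forall>x. x \<notin> D \<longrightarrow> f x = 0) \<and> sup_norm D f < \<infinity>}"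


section \<open>Reproducing kernel Hilbert spaces\<close>

text \<open>As usual for reproducing kernels, positive definiteness is the non-strict inequality.
  The double sum is real by Hermitian symmetry.\<close>

definition hermitian_pos_def_kernel :: "'a set \<Rightarrow> ('a \<Rightarrow> 'a \<Rightarrow> complex) \<Rightarrow> bool" where
  "hermitian_pos_def_kernel D K \<longleftrightarrow>
     (\<forall>x\<in>D. \<forall>y\<in>D. K y x = cnj (K x y)) \<and>
     (\<forall>(n::nat) x c. (\<forall>i<n. x i \<in> D) \<longrightarrow>
        0 \<le> Re (\<Sum>i<n. \<Sum>j<n. cnj (c i) * c j * K (x i) (x j)))"

definition kernel_section :: "'a set \<Rightarrow> ('a \<Rightarrow> 'a \<Rightarrow> complex) \<Rightarrow> 'a \<Rightarrow> 'a \<Rightarrow> complex" where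
  "kernel_section D K x = (\<lambda>y. if y \<in> D then K y x else 0)"

definition ip_norm ::
    "(('a \<Rightarrow> complex) \<Rightarrow> ('a \<Rightarrow> complex) \<Rightarrow> complex) \<Rightarrow> ('a \<Rightarrow> complex) \<Rightarrow> real" where
  "ip_norm ip f = sqrt (Re (ip f f))"

text \<open>By the Moore-Aronszajn theorem a Hermitian positive definite kernel \<open>K\<close> on \<open>D\<close>
  determines the set \<open>H\<close>, and the values of \<open>ip\<close> on \<open>H\<close>, uniquely.
  The inner product is linear in its first argument.\<close>

locale rkhs =
  fixes D :: "'a set" and K :: "'a \<Rightarrow> 'a \<Rightarrow> complex"
    and H :: "('a \<Rightarrow> complex) set"
    and ip :: "('a \<Rightarrow> complex) \<Rightarrow> ('a \<Rightarrow> complex) \<Rightarrow> complex"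
  assumes vanish: "f \<in> H \<Longrightarrow> x \<notin> D \<Longrightarrow> f x = 0"
    and subspace: "cfun.subspace H"
    and ip_add: "f \<in> H \<Longrightarrow> g \<in> H \<Longrightarrow> h \<in> H \<Longrightarrow> ip (f + g) h = ip f h + ip g h"
    and ip_scale: "f \<in> H \<Longrightarrow> g \<in> H \<Longrightarrow> ip (cscale c f) g = c * ip f g"
    and ip_cnj: "f \<in> H \<Longrightarrow> g \<in> H \<Longrightarrow> ip g f = cnj (ip f g)"
    and ip_nonneg: "f \<in> H \<Longrightarrow> 0 \<le> Re (ip f f)"
    and ip_definite: "f \<in> H \<Longrightarrow> ip f f = 0 \<Longrightarrow> f = 0"
    and complete: "(\<And>n. X n \<in> H) \<Longrightarrow>
        (\<forall>\<epsilon>>0. \<exists>N. \<forall>m\<ge>N. \<forall>n\<ge>N. ip_norm ip (X m - X n) < \<epsilon>) \<Longrightarrow>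
        \<exists>f\<in>H. (\<lambda>n::nat. ip_norm ip (X n - f)) \<longlonglongrightarrow> 0"
    and kernel_in: "x \<in> D \<Longrightarrow> kernel_section D K x \<in> H"
    and reproducing: "f \<in> H \<Longrightarrow> x \<in> D \<Longrightarrow> f x = ip f (kernel_section D K x)"


section \<open>Approximation numbers and sampling numbers\<close>

text \<open>Numbers of the embedding \<open>Id : H(K) \<rightarrow> \<ell>\<^sub>\<infinity>(D)\<close>.  In \<open>approx_number\<close>
  the continuity of the linear map \<open>A\<close> is expressed by its boundedness.\<close>

definition unit_ball ::
    "('a \<Rightarrow> complex) set \<Rightarrow> (('a \<Rightarrow> complex) \<Rightarrow> ('a \<Rightarrow> complex) \<Rightarrow> complex)
      \<Rightarrow> ('a \<Rightarrow> complex) set" where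
  "unit_ball H ip = {f \<in> H. ip_norm ip f \<le> 1}"

definition approx_number ::
    "'a set \<Rightarrow> ('a \<Rightarrow> complex) set \<Rightarrow> (('a \<Rightarrow> complex) \<Rightarrow> ('a \<Rightarrow> complex) \<Rightarrow> complex)
      \<Rightarrow> nat \<Rightarrow> ennreal" where
  "approx_number D H ip n =
     (INF A \<in> {A. linear_map_on H A \<and> A ` H \<subseteq> l_infinity D \<and>
                  (\<exists>C::real. \<forall>f\<in>H. sup_norm D (A f) \<le> ennreal (C * ip_norm ip f)) \<and>
                  rank_less H A n}.
        SUP f \<in> unit_ball H ip. sup_norm D (f - A f))"

definition sampling_number ::
    "'a set \<Rightarrow> ('a \<Rightarrow> complex) set \<Rightarrow> (('a \<Rightarrow> complex) \<Rightarrow> ('a \<Rightarrow> complex) \<Rightarrow> complex)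
      \<Rightarrow> nat \<Rightarrow> ennreal" where
  "sampling_number D H ip n =
     (INF x \<in> {x :: nat \<Rightarrow> 'a. \<forall>i<n. x i \<in> D}.
      INF R \<in> {R. linear_map_on (complex_tuples n) R \<and> R ` complex_tuples n \<subseteq> l_infinity D}.
        SUP f \<in> unit_ball H ip. sup_norm D (f - R (\<lambda>i. if i < n then f (x i) else 0)))"

definition optimal_order :: "(nat \<Rightarrow> ennreal) \<Rightarrow> ereal" where
  "optimal_order s =
     (SUP q \<in> {q::real. 0 \<le> q \<and> (\<lambda>n. ennreal (real n powr q) * s n) \<longlonglongrightarrow> 0}. ereal q)"

definition q_lin ::
    "'a set \<Rightarrow> ('a \<Rightarrow> complex) set \<Rightarrow> (('a \<Rightarrow> complex) \<Rightarrow> ('a \<Rightarrow> complex) \<Rightarrow> complex) \<Rightarrow> ereal" where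
  "q_lin D H ip = optimal_order (approx_number D H ip)"

definition q_std ::
    "'a set \<Rightarrow> ('a \<Rightarrow> complex) set \<Rightarrow> (('a \<Rightarrow> complex) \<Rightarrow> ('a \<Rightarrow> complex) \<Rightarrow> complex) \<Rightarrow> ereal" where
  "q_std D H ip = optimal_order (sampling_number D H ip)"


section \<open>Spectral data of the embedding into \<open>L\<^sub>2\<close>\<close>

definition finite_borel_measure_on :: "'a::topological_space set \<Rightarrow> 'a measure \<Rightarrow> bool" where
  "finite_borel_measure_on D M \<longleftrightarrow> sets M = sets (restrict_space borel D) \<and> finite_measure M"

definition full_support :: "'a::topological_space set \<Rightarrow> 'a measure \<Rightarrow> bool" where
  "full_support D M \<longleftrightarrow> (\<forall>U. openin (top_of_set D) U \<and> U \<noteq> {} \<longrightarrow> 0 < emeasure M U)"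

definition L2_ip :: "'a measure \<Rightarrow> ('a \<Rightarrow> complex) \<Rightarrow> ('a \<Rightarrow> complex) \<Rightarrow> complex" where
  "L2_ip M f g = (\<integral>x. f x * cnj (g x) \<partial>M)"

text \<open>\<open>J_adjoint H ip M f\<close> is \<open>J\<^sup>* f\<close> for the embedding \<open>J : H \<rightarrow> L\<^sub>2(M)\<close>,
  where \<open>f\<close> is any representative of an element of \<open>L\<^sub>2(M)\<close>.  As \<open>J\<close> maps a function to its
  class, the same term with \<open>f \<in> H\<close> is \<open>J\<^sup>*J f\<close>.\<close>

definition J_adjoint ::
    "('a \<Rightarrow> complex) set \<Rightarrow> (('a \<Rightarrow> complex) \<Rightarrow> ('a \<Rightarrow> complex) \<Rightarrow> complex) \<Rightarrow> 'a measure
      \<Rightarrow> ('a \<Rightarrow> complex) \<Rightarrow> ('a \<Rightarrow> complex)" where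
  "J_adjoint H ip M f = (THE h. h \<in> H \<and> (\<forall>g\<in>H. ip h g = L2_ip M f g))"

text \<open>Sequences are indexed from \<open>1\<close>; the values at \<open>0\<close> are irrelevant.  The last clause says that
  every positive eigenvalue of \<open>J\<^sup>*J\<close> occurs in \<open>\<lambda>\<close>, repeated according to its multiplicity.\<close>

definition spectral_data ::
    "('a \<Rightarrow> complex) set \<Rightarrow> (('a \<Rightarrow> complex) \<Rightarrow> ('a \<Rightarrow> complex) \<Rightarrow> complex) \<Rightarrow> 'a measure
      \<Rightarrow> (nat \<Rightarrow> real) \<Rightarrow> (nat \<Rightarrow> 'a \<Rightarrow> complex) \<Rightarrow> bool" where
  "spectral_data H ip M lam e \<longleftrightarrow>
     (\<forall>k\<ge>1. 0 < lam k) \<and> (\<forall>i j. 1 \<le> i \<and> i \<le> j \<longrightarrow> lam j \<le> lam i) \<and>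
     (\<forall>k\<ge>1. e k \<in> H \<and> J_adjoint H ip M (e k) = cscale (of_real (lam k)) (e k)) \<and>
     (\<forall>i\<ge>1. \<forall>j\<ge>1. ip (e i) (e j) = (if i = j then 1 else 0)) \<and>
     (\<forall>\<mu>>0. {f \<in> H. J_adjoint H ip M f = cscale (of_real \<mu>) f}
             = cfun.span (e ` {k. 1 \<le> k \<and> lam k = \<mu>}))"

definition sing_number :: "(nat \<Rightarrow> real) \<Rightarrow> nat \<Rightarrow> real" where
  "sing_number lam k = sqrt (lam k)"

definition eta :: "(nat \<Rightarrow> real) \<Rightarrow> (nat \<Rightarrow> 'a \<Rightarrow> complex) \<Rightarrow> nat \<Rightarrow> 'a \<Rightarrow> complex" where
  "eta lam e k = cscale (of_real (inverse (sing_number lam k))) (e k)"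

text \<open>The supremum is a real one; for a bounded kernel it is taken over a bounded set, because
  \<open>|e k x| \<le> sqrt (K x x)\<close>.\<close>

definition spectral_function ::
    "'a set \<Rightarrow> (nat \<Rightarrow> real) \<Rightarrow> (nat \<Rightarrow> 'a \<Rightarrow> complex) \<Rightarrow> nat \<Rightarrow> real" where
  "spectral_function D lam e m = (SUP x\<in>D. \<Sum>k\<in>{1..<m}. (cmod (eta lam e k x))\<^sup>2)"

definition spectral_growth ::
    "'a set \<Rightarrow> (nat \<Rightarrow> real) \<Rightarrow> (nat \<Rightarrow> 'a \<Rightarrow> complex) \<Rightarrow> real \<Rightarrow> bool" where
  "spectral_growth D lam e u \<longleftrightarrow> spectral_function D lam e \<in> O(\<lambda>k. real k powr u)"

definition sing_decay :: "(nat \<Rightarrow> real) \<Rightarrow> real \<Rightarrow> bool" where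
  "sing_decay lam p \<longleftrightarrow> (\<exists>C>0. \<forall>j\<ge>1. sing_number lam j \<le> C * real j powr (- p))"

end

(*
  For an H-orthonormal set S the power function at x is K(x,x) - sum_{q in S} |q(x)|^2, the squared
  distance of the kernel section K_x to the span of S; its supremum bounds the squared error of the
  projection onto span S in the sup norm. If S lies in the span of kernel sections, this projection
  samples f at the corresponding points only.

  Upper bound. Suppose N points have power function at most s^2, and the span of the first m
  eigenfunctions has power function at most d^2. Then n greedily chosen further points have power
  function at most (s sqrt(m/n) + d)^2: otherwise the new orthonormal functions q_1, ..., q_n would
  all have large values, hence large components in the m-dimensional eigenspace, against Bessel's
  inequality. Iterating with N = n = 2^k, m = 2^(k-2l) transfers the rate of d to the sampling points.
  The rate d = O(m^-(p-u/2)) comes from K(x,x) = sum |e_k(x)|^2, that is, from the completeness of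
  the eigenfunctions, by summing over dyadic blocks.

  Lower bound. A linear map of rank at most n annihilates an n-dimensional subspace of the span of
  e_1, ..., e_{2n}. On it the error dominates point values; integrating the diagonal of its reproducing
  kernel gives n lam_{2n} <= error^2 rho(D). The optimality of p then bounds both orders by p - 1/2.
*)
theory Submission
  imports Defs "HOL-Complex_Analysis.Great_Picard"
begin

text \<open>The eigenfunctions need not be combinations of kernel sections, so they cannot supply
  sampling functionals; they are only a yardstick that shows how well the greedy points do. Fixing
  the ratio of \<open>m\<close> to \<open>n\<close> leaves the exponent of the rate unchanged and
  costs only a constant.

  The main obstacle is completeness: \<open>spectral_data\<close> lists the positive eigenvalues
  with their eigenspaces but does not say that the eigenfunctions span a dense subspace. If they did
  not, maximizing the \<open>L2\<close> norm over the unit ball of their orthogonal complement would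
  produce one more eigenfunction. The maximum is attained because bounded sets of \<open>H\<close>
  are equicontinuous on the compact \<open>D\<close>, and it is positive because full support makes
  the \<open>L2\<close> form definite on \<open>H\<close>.

  The factor \<open>n\<close> in \<open>n * lam (2 * n)\<close> is the source of the 1/2: an error
  of order \<open>n powr (- q)\<close> forces singular numbers of order
  \<open>n powr (- (q + 1 / 2))\<close>, and \<open>p\<close> is the supremum of such
  exponents.\<close>

lemma cscale_apply: "cscale c f x = c * f x"
  by (simp add: cscale_def)

lemma sum_fun_apply: "(\<Sum>i\<in>I. f i) x = (\<Sum>i\<in>I. (f i x :: 'b::comm_monoid_add))"
  by (induction I rule: infinite_finite_induct) auto

section \<open>Hermitian forms\<close>

text \<open>The same algebra is needed for \<open>ip\<close> and for \<open>L2_ip M\<close> on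
  \<open>H\<close>. Definiteness stays outside: for \<open>ip\<close> it is an axiom, for
  \<open>L2_ip M\<close> it has a topological proof in \<open>L2_definite\<close>.\<close>

locale hermitian_form =
  fixes V :: "('a \<Rightarrow> complex) set"
    and B :: "('a \<Rightarrow> complex) \<Rightarrow> ('a \<Rightarrow> complex) \<Rightarrow> complex"
  assumes subsp: "cfun.subspace V"
    and add_left: "f \<in> V \<Longrightarrow> g \<in> V \<Longrightarrow> h \<in> V \<Longrightarrow> B (f + g) h = B f h + B g h"
    and scale_left: "f \<in> V \<Longrightarrow> g \<in> V \<Longrightarrow> B (cscale c f) g = c * B f g"
    and conj_sym: "f \<in> V \<Longrightarrow> g \<in> V \<Longrightarrow> B g f = cnj (B f g)"
    and nonneg: "f \<in> V \<Longrightarrow> 0 \<le> Re (B f f)"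
begin

lemma mem_add: "f \<in> V \<Longrightarrow> g \<in> V \<Longrightarrow> f + g \<in> V"
  using subsp by (rule cfun.subspace_add)

lemma mem_diff: "f \<in> V \<Longrightarrow> g \<in> V \<Longrightarrow> f - g \<in> V"
  using subsp by (rule cfun.subspace_diff)

lemma mem_scale: "f \<in> V \<Longrightarrow> cscale c f \<in> V"
  using subsp by (rule cfun.subspace_scale)

lemma mem_zero: "0 \<in> V"
  using subsp by (rule cfun.subspace_0)

lemma mem_sum: "(\<And>i. i \<in> I \<Longrightarrow> f i \<in> V) \<Longrightarrow> (\<Sum>i\<in>I. f i) \<in> V"
  using subsp by (rule cfun.subspace_sum)

lemma mem_span: "S \<subseteq> V \<Longrightarrow> cfun.span S \<subseteq> V"
  using subsp by (simp add: cfun.span_minimal)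

lemmas mem = mem_add mem_diff mem_scale mem_zero mem_sum

lemma add_right: "f \<in> V \<Longrightarrow> g \<in> V \<Longrightarrow> h \<in> V \<Longrightarrow> B h (f + g) = B h f + B h g"
  using conj_sym[of "f + g" h] conj_sym[of f h] conj_sym[of g h] add_left[of f g h]
  by (simp add: mem_add)

lemma scale_right: "f \<in> V \<Longrightarrow> g \<in> V \<Longrightarrow> B g (cscale c f) = cnj c * B g f"
  using conj_sym[of "cscale c f" g] conj_sym[of f g] scale_left[of f g c]
  by (simp add: mem_scale)

lemma zero_left: "g \<in> V \<Longrightarrow> B 0 g = 0"
  using add_left[of 0 0 g] mem_zero by simp

lemma zero_right: "g \<in> V \<Longrightarrow> B g 0 = 0"
  using add_right[of 0 0 g] mem_zero by simp

lemma diff_left: "f \<in> V \<Longrightarrow> g \<in> V \<Longrightarrow> h \<in> V \<Longrightarrow> B (f - g) h = B f h - B g h"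
  using add_left[of "f - g" g h] by (simp add: mem_diff)

lemma diff_right: "f \<in> V \<Longrightarrow> g \<in> V \<Longrightarrow> h \<in> V \<Longrightarrow> B h (f - g) = B h f - B h g"
  using add_right[of "f - g" g h] by (simp add: mem_diff)

lemma sum_left:
  assumes "\<And>i. i \<in> I \<Longrightarrow> f i \<in> V" "g \<in> V"
  shows "B (\<Sum>i\<in>I. f i) g = (\<Sum>i\<in>I. B (f i) g)"
  using assms(1)
  by (induction I rule: infinite_finite_induct)
    (simp_all add: zero_left add_left mem_sum assms(2))

lemma sum_right:
  assumes "\<And>i. i \<in> I \<Longrightarrow> f i \<in> V" "g \<in> V"
  shows "B g (\<Sum>i\<in>I. f i) = (\<Sum>i\<in>I. B g (f i))"
  using assms(1)
  by (induction I rule: infinite_finite_induct)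
    (simp_all add: zero_right add_right mem_sum assms(2))

lemma self_real: "f \<in> V \<Longrightarrow> B f f = of_real (Re (B f f))"
  using conj_sym[of f f] by (simp add: complex_eq_iff)

lemma Re_sym: "f \<in> V \<Longrightarrow> g \<in> V \<Longrightarrow> Re (B g f) = Re (B f g)"
  using conj_sym[of f g] by simp

lemma Re_add_self:
  "f \<in> V \<Longrightarrow> g \<in> V \<Longrightarrow> Re (B (f + g) (f + g)) = Re (B f f) + 2 * Re (B f g) + Re (B g g)"
  by (simp add: add_left add_right mem_add Re_sym)

lemma Re_diff_self:
  "f \<in> V \<Longrightarrow> g \<in> V \<Longrightarrow> Re (B (f - g) (f - g)) = Re (B f f) - 2 * Re (B f g) + Re (B g g)"
  by (simp add: diff_left diff_right mem_diff Re_sym)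

lemma Re_scale_self:
  assumes "f \<in> V" shows "Re (B (cscale c f) (cscale c f)) = (cmod c)\<^sup>2 * Re (B f f)"
proof -
  have "B (cscale c f) (cscale c f) = (c * cnj c) * B f f"
    by (simp add: scale_left scale_right mem_scale assms)
  also have "\<dots> = of_real ((cmod c)\<^sup>2) * of_real (Re (B f f))"
    by (simp only: complex_norm_square[symmetric] self_real[OF assms, symmetric])
  finally show ?thesis by simp
qed

text \<open>This is a first variation along a real line; together with
  \<open>quadratic_nonneg_imp_zero\<close> it yields the stationarity conditions of the two extremal
  problems below.\<close>

lemma Re_combination_self:
  assumes "f \<in> V" "g \<in> V"
  shows "Re (B (f + cscale (of_real t) g) (f + cscale (of_real t) g))
    = Re (B f f) + 2 * t * Re (B f g) + t\<^sup>2 * Re (B g g)"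
  unfolding Re_add_self[OF assms(1) mem_scale[OF assms(2)]] Re_scale_self[OF assms(2)]
    scale_right[OF assms(2,1)]
  by simp

lemma parallelogram:
  "f \<in> V \<Longrightarrow> g \<in> V \<Longrightarrow>
    Re (B (f + g) (f + g)) + Re (B (f - g) (f - g)) = 2 * Re (B f f) + 2 * Re (B g g)"
  by (simp add: Re_add_self Re_diff_self)

lemma Cauchy_Schwarz:
  assumes f: "f \<in> V" and g: "g \<in> V"
  shows "(cmod (B f g))\<^sup>2 \<le> Re (B f f) * Re (B g g)"
proof -
  define w where "w = B f g"
  have key: "0 \<le> Re (B f f) + 2 * t * (cmod w)\<^sup>2 + t\<^sup>2 * ((cmod w)\<^sup>2 * Re (B g g))" for t
  proof -
    \<comment> \<open>The direction \<open>cscale w g\<close> carries the phase of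
      \<open>B f g\<close>, which makes the cross term real.\<close>
    have "0 \<le> Re (B (f + cscale (of_real t) (cscale w g)) (f + cscale (of_real t) (cscale w g)))"
      by (intro nonneg mem f g)
    also have "\<dots> = Re (B f f) + 2 * t * Re (B f (cscale w g)) + t\<^sup>2 * ((cmod w)\<^sup>2 * Re (B g g))"
      unfolding Re_combination_self[OF f mem_scale[OF g]] Re_scale_self[OF g] ..
    also have "Re (B f (cscale w g)) = Re (w * cnj w)"
      by (simp add: scale_right f g w_def mult.commute)
    also have "Re (w * cnj w) = (cmod w)\<^sup>2"
      by (simp add: complex_mult_cnj cmod_power2)
    finally show ?thesis .
  qed
  have gg: "0 \<le> Re (B g g)" by (rule nonneg[OF g])
  show ?thesis
  proof (cases "Re (B g g) = 0")
    \<comment> \<open>The form may be degenerate. The expression is then affine in \<open>t\<close>,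
      and unless \<open>w = 0\<close> the chosen \<open>t\<close> gives it the value -1.\<close>
    case True
    have "(cmod w)\<^sup>2 = 0"
    proof (rule ccontr)
      assume "(cmod w)\<^sup>2 \<noteq> 0"
      then have "Re (B f f) + 2 * (- (Re (B f f) + 1) / (2 * (cmod w)\<^sup>2)) * (cmod w)\<^sup>2 = -1"
        by (simp add: field_simps)
      with key[of "- (Re (B f f) + 1) / (2 * (cmod w)\<^sup>2)"] True show False by simp
    qed
    then show ?thesis using True by (simp add: w_def)
  next
    case False
    with gg have pos: "Re (B g g) > 0" by simp
    from key[of "- 1 / Re (B g g)"] pos
    have "0 \<le> Re (B f f) - (cmod w)\<^sup>2 / Re (B g g)"
      by (simp add: field_simps power2_eq_square)
    then show ?thesis using pos by (simp add: w_def field_simps)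
  qed
qed

lemma cmod_le:
  "f \<in> V \<Longrightarrow> g \<in> V \<Longrightarrow> cmod (B f g) \<le> sqrt (Re (B f f)) * sqrt (Re (B g g))"
  using real_sqrt_le_mono[OF Cauchy_Schwarz[of f g]] by (simp add: real_sqrt_mult)

end

text \<open>Near 0 the linear term dominates. The point \<open>t = - b / A\<close> is near enough,
  since \<open>A\<close> is positive and at least \<open>a\<close> whatever the sign of
  \<open>a\<close>.\<close>

lemma quadratic_nonneg_imp_zero:
  fixes a b :: real
  assumes "\<And>t. 0 \<le> 2 * t * b + t\<^sup>2 * a"
  shows "b = 0"
proof (rule ccontr)
  assume b: "b \<noteq> 0"
  define A where "A = \<bar>a\<bar> + 1"
  have A: "A > 0" "a \<le> A" by (auto simp: A_def)
  have "0 \<le> 2 * (- b / A) * b + (- b / A)\<^sup>2 * a" by (rule assms)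
  also have "\<dots> \<le> 2 * (- b / A) * b + (- b / A)\<^sup>2 * A"
    using A by (intro add_left_mono mult_left_mono) auto
  also have "\<dots> = - (b\<^sup>2 / A)" using A by (simp add: field_simps power2_eq_square)
  also have "\<dots> < 0" using b A by simp
  finally show False by simp
qed

section \<open>Orthonormal sets and the power function\<close>

context rkhs
begin

sublocale form: hermitian_form H ip
  by unfold_locales (fact subspace ip_add ip_scale ip_cnj ip_nonneg)+

abbreviation ker :: "'a \<Rightarrow> 'a \<Rightarrow> complex" where "ker \<equiv> kernel_section D K"

abbreviation sqn :: "('a \<Rightarrow> complex) \<Rightarrow> real" where "sqn f \<equiv> Re (ip f f)"

lemma ip_norm_sq: "f \<in> H \<Longrightarrow> (ip_norm ip f)\<^sup>2 = sqn f"
  by (simp add: ip_norm_def ip_nonneg)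

lemma sqn_zero_iff: "f \<in> H \<Longrightarrow> sqn f = 0 \<longleftrightarrow> f = 0"
  using form.self_real[of f] ip_definite[of f] form.zero_left[OF form.mem_zero] by auto

definition orthonormal_set :: "('a \<Rightarrow> complex) set \<Rightarrow> bool" where
  "orthonormal_set S \<longleftrightarrow> finite S \<and> S \<subseteq> H \<and> (\<forall>f\<in>S. \<forall>g\<in>S. ip f g = (if f = g then 1 else 0))"

definition power2_fun :: "('a \<Rightarrow> complex) set \<Rightarrow> 'a \<Rightarrow> real" where
  "power2_fun S x = sqn (ker x) - (\<Sum>q\<in>S. (cmod (q x))\<^sup>2)"

definition proj :: "('a \<Rightarrow> complex) set \<Rightarrow> ('a \<Rightarrow> complex) \<Rightarrow> 'a \<Rightarrow> complex" where
  "proj S f = (\<Sum>q\<in>S. cscale (ip f q) q)"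

lemma orthonormal_setD:
  assumes "orthonormal_set S"
  shows "finite S" "S \<subseteq> H" "q \<in> S \<Longrightarrow> q \<in> H"
    "f \<in> S \<Longrightarrow> g \<in> S \<Longrightarrow> ip f g = (if f = g then 1 else 0)"
  using assms by (auto simp: orthonormal_set_def)

lemma proj_mem: "orthonormal_set S \<Longrightarrow> proj S f \<in> H"
  unfolding proj_def by (intro form.mem) (auto dest: orthonormal_setD)

lemma proj_span: "proj S f \<in> cfun.span S"
  unfolding proj_def by (intro cfun.span_sum cfun.span_scale cfun.span_base)

lemma ip_combination_left:
  assumes "orthonormal_set S" "q \<in> S"
  shows "ip (\<Sum>r\<in>S. cscale (c r) r) q = c q"
proof -
  have "ip (\<Sum>r\<in>S. cscale (c r) r) q = (\<Sum>r\<in>S. ip (cscale (c r) r) q)"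
    using orthonormal_setD[OF assms(1)] assms(2) by (intro form.sum_left) (auto intro: form.mem)
  also have "\<dots> = (\<Sum>r\<in>S. if r = q then c r else 0)"
    using orthonormal_setD[OF assms(1)] assms(2) by (intro sum.cong refl) (auto simp: form.scale_left)
  finally show ?thesis using orthonormal_setD(1)[OF assms(1)] assms(2) by simp
qed

lemma sqn_combination:
  assumes "orthonormal_set S"
  shows "sqn (\<Sum>r\<in>S. cscale (c r) r) = (\<Sum>r\<in>S. (cmod (c r))\<^sup>2)"
proof -
  let ?f = "\<Sum>r\<in>S. cscale (c r) r"
  have fH: "?f \<in> H" using orthonormal_setD[OF assms] by (intro form.mem) auto
  have "ip ?f ?f = (\<Sum>r\<in>S. ip ?f (cscale (c r) r))"
    using orthonormal_setD[OF assms] fH by (intro form.sum_right) (auto intro: form.mem)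
  also have "\<dots> = (\<Sum>r\<in>S. cnj (c r) * c r)"
    using orthonormal_setD[OF assms] fH
    by (intro sum.cong refl) (auto simp: form.scale_right ip_combination_left[OF assms])
  finally have "ip ?f ?f = (\<Sum>r\<in>S. of_real ((cmod (c r))\<^sup>2))"
    by (simp only: complex_norm_square mult.commute)
  then show ?thesis by simp
qed

lemma span_coefficients:
  assumes "orthonormal_set S" "f \<in> cfun.span S"
  shows "f = proj S f"
proof -
  obtain c where c: "f = (\<Sum>r\<in>S. cscale (c r) r)"
    using assms cfun.span_finite[OF orthonormal_setD(1)[OF assms(1)]] by auto
  have "proj S f = (\<Sum>r\<in>S. cscale (c r) r)"
    unfolding proj_def by (intro sum.cong refl) (simp add: c ip_combination_left[OF assms(1)])
  with c show ?thesis by simp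
qed

lemma ip_sub_proj:
  assumes "orthonormal_set S" "f \<in> H" "q \<in> S"
  shows "ip (f - proj S f) q = 0"
  using ip_combination_left[OF assms(1,3), of "ip f"] assms orthonormal_setD[OF assms(1)]
  by (simp add: form.diff_left proj_mem proj_def[symmetric])

lemma ip_sub_proj_span:
  assumes "orthonormal_set S" "f \<in> H" "g \<in> cfun.span S"
  shows "ip (f - proj S f) g = 0"
proof -
  let ?r = "f - proj S f"
  have r: "?r \<in> H" using assms by (intro form.mem proj_mem)
  have "ip ?r (\<Sum>q\<in>S. cscale (ip g q) q) = (\<Sum>q\<in>S. ip ?r (cscale (ip g q) q))"
    using r orthonormal_setD[OF assms(1)] by (intro form.sum_right) (auto intro: form.mem)
  also have "\<dots> = 0"
    using r orthonormal_setD[OF assms(1)]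
    by (intro sum.neutral ballI) (auto simp: form.scale_right ip_sub_proj[OF assms(1,2)])
  finally show ?thesis using span_coefficients[OF assms(1,3)] by (simp add: proj_def)
qed

lemma sqn_sub_proj:
  assumes "orthonormal_set S" "f \<in> H"
  shows "sqn (f - proj S f) = sqn f - (\<Sum>q\<in>S. (cmod (ip f q))\<^sup>2)"
proof -
  let ?p = "proj S f"
  have p: "?p \<in> H" using assms by (intro proj_mem)
  have "ip f ?p = ip ?p ?p"
    using ip_sub_proj_span[OF assms proj_span, of f] form.diff_left[OF assms(2) p p] by simp
  then have "sqn (f - ?p) = sqn f - sqn ?p" by (simp add: form.Re_diff_self assms p)
  then show ?thesis using sqn_combination[OF assms(1), of "ip f"] by (simp add: proj_def)
qed

lemma Bessel:
  assumes "orthonormal_set S" "f \<in> H"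
  shows "(\<Sum>q\<in>S. (cmod (ip f q))\<^sup>2) \<le> sqn f"
  using sqn_sub_proj[OF assms] ip_nonneg[OF form.mem_diff[OF assms(2) proj_mem[OF assms(1)]]]
  by (metis assms(1) diff_ge_0_iff_ge)

lemma proj_least:
  assumes "orthonormal_set S" "f \<in> H" "g \<in> cfun.span S"
  shows "sqn (f - proj S f) \<le> sqn (f - g)"
proof -
  let ?p = "proj S f"
  have p: "?p \<in> H" using assms by (intro proj_mem)
  have g: "g \<in> H" using assms form.mem_span orthonormal_setD by blast
  have d: "?p - g \<in> cfun.span S" by (intro cfun.span_diff proj_span assms)
  have "f - g = (f - ?p) + (?p - g)" by (rule ext) simp
  then have "sqn (f - g) = sqn ((f - ?p) + (?p - g))" by (rule arg_cong)
  also have "\<dots> = sqn (f - ?p) + 2 * Re (ip (f - ?p) (?p - g)) + sqn (?p - g)"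
    by (intro form.Re_add_self form.mem p g assms)
  also have "ip (f - ?p) (?p - g) = 0" by (rule ip_sub_proj_span[OF assms(1,2) d])
  finally show ?thesis using ip_nonneg[OF form.mem_diff[OF p g]] unfolding zero_complex.sel by linarith
qed

lemma ip_ker_cnj: "x \<in> D \<Longrightarrow> f \<in> H \<Longrightarrow> ip (ker x) f = cnj (f x)"
  using form.conj_sym[of f "ker x"] reproducing[of f x] kernel_in[of x] by simp

lemma power2_fun_eq:
  assumes "orthonormal_set S" "x \<in> D"
  shows "power2_fun S x = sqn (ker x - proj S (ker x))"
proof -
  have "(\<Sum>q\<in>S. (cmod (ip (ker x) q))\<^sup>2) = (\<Sum>q\<in>S. (cmod (q x))\<^sup>2)"
    using orthonormal_setD[OF assms(1)] by (intro sum.cong refl) (simp add: ip_ker_cnj assms)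
  then show ?thesis
    unfolding power2_fun_def by (simp add: sqn_sub_proj[OF assms(1) kernel_in[OF assms(2)]])
qed

lemma power2_fun_nonneg: "orthonormal_set S \<Longrightarrow> x \<in> D \<Longrightarrow> 0 \<le> power2_fun S x"
  by (simp add: power2_fun_eq ip_nonneg form.mem proj_mem kernel_in)

text \<open>A larger span is nearer to the kernel section. The inclusion is into the span because
  Gram-Schmidt puts the eigenfunctions into the span of the new set, not into the set.\<close>

lemma power2_fun_mono:
  assumes "orthonormal_set S" "orthonormal_set T" "S \<subseteq> cfun.span T" "x \<in> D"
  shows "power2_fun T x \<le> power2_fun S x"
proof -
  have "proj S (ker x) \<in> cfun.span T"
    using proj_span[of S "ker x"] assms(3) by (metis cfun.span_minimal cfun.subspace_span subsetD)
  then show ?thesis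
    by (simp add: power2_fun_eq assms proj_least kernel_in)
qed

section \<open>Normalization and Gram-Schmidt\<close>

lemma orthonormal_set_insert:
  assumes "orthonormal_set S" "f \<in> H" "\<And>q. q \<in> S \<Longrightarrow> ip f q = 0" "sqn f = 1"
  shows "orthonormal_set (insert f S)" "f \<notin> S"
proof -
  have ff: "ip f f = 1" using form.self_real[OF assms(2)] assms(4) by simp
  show nin: "f \<notin> S" using assms(3)[of f] ff by auto
  have "ip q f = 0" if "q \<in> S" for q
    using form.conj_sym[of f q] assms(3)[OF that] that orthonormal_setD(3)[OF assms(1)] assms(2) by simp
  then show "orthonormal_set (insert f S)"
    using assms ff nin unfolding orthonormal_set_def by auto
qed

lemma sqn_normalized:
  assumes "f \<in> H" "f \<noteq> 0"
  shows "sqn (cscale (of_real (1 / sqrt (sqn f))) f) = 1"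
    "f = cscale (of_real (sqrt (sqn f))) (cscale (of_real (1 / sqrt (sqn f))) f)"
proof -
  have pos: "sqn f > 0" using assms sqn_zero_iff ip_nonneg[of f] by force
  have "sqn (cscale (of_real (1 / sqrt (sqn f))) f) = (cmod (of_real (1 / sqrt (sqn f))))\<^sup>2 * sqn f"
    by (rule form.Re_scale_self[OF assms(1)])
  also have "\<dots> = 1" using pos by (simp add: norm_divide power_divide)
  finally show "sqn (cscale (of_real (1 / sqrt (sqn f))) f) = 1" .
  have "complex_of_real (sqrt (sqn f)) * of_real (1 / sqrt (sqn f)) = 1"
    using pos by (simp flip: of_real_mult)
  then show "f = cscale (of_real (sqrt (sqn f))) (cscale (of_real (1 / sqrt (sqn f))) f)"
    by (simp only: cfun.scale_scale cfun.scale_one)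
qed

lemma Gram_Schmidt_step:
  assumes "orthonormal_set S" "f \<in> H"
  obtains B where "orthonormal_set (S \<union> B)" "S \<inter> B = {}" "finite B" "card B \<le> 1"
    "f \<in> cfun.span (S \<union> B)"
proof (cases "f - proj S f = 0")
  case True
  then have "f = proj S f" by simp
  then have "f \<in> cfun.span S" using proj_span[of S f] by metis
  then show ?thesis using assms that[of "{}"] by auto
next
  case False
  let ?r = "f - proj S f"
  let ?q = "cscale (of_real (1 / sqrt (sqn ?r))) ?r"
  have r: "?r \<in> H" using assms by (intro form.mem proj_mem)
  note n = sqn_normalized[OF r False]
  have orth: "ip ?q q = 0" if "q \<in> S" for q
  proof -
    have "q \<in> H" using that assms orthonormal_setD by blast
    then have "ip ?q q = of_real (1 / sqrt (sqn ?r)) * ip ?r q" by (rule form.scale_left[OF r])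
    then show ?thesis using ip_sub_proj[OF assms that] by simp
  qed
  note ins = orthonormal_set_insert[OF assms(1) form.mem_scale[OF r] orth n(1)]
  have "?r \<in> cfun.span (S \<union> {?q})"
    by (subst n(2)) (intro cfun.span_scale cfun.span_base, simp)
  moreover have "proj S f \<in> cfun.span (S \<union> {?q})"
    using proj_span[of S f] cfun.span_mono[of S "S \<union> {?q}"] by blast
  ultimately have "?r + proj S f \<in> cfun.span (S \<union> {?q})" by (rule cfun.span_add)
  then have "f \<in> cfun.span (S \<union> {?q})" by simp
  then show ?thesis using ins that[of "{?q}"] by auto
qed

text \<open>\<open>S\<close> is kept and each vector of \<open>W\<close> adds at most one new one.
  Thus \<open>card B\<close> bounds the number of directions in which functions orthogonal to
  \<open>S\<close> can meet the span of \<open>W\<close>.\<close>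

lemma Gram_Schmidt:
  assumes "finite W" "orthonormal_set S" "W \<subseteq> H"
  shows "\<exists>B. orthonormal_set (S \<union> B) \<and> S \<inter> B = {} \<and> finite B \<and> card B \<le> card W \<and>
    W \<subseteq> cfun.span (S \<union> B)"
  using assms(1,3)
proof (induction W rule: finite_induct)
  case empty
  then show ?case using assms(2) by (intro exI[of _ "{}"]) auto
next
  case (insert f W)
  then obtain B where B: "orthonormal_set (S \<union> B)" "S \<inter> B = {}" "finite B" "card B \<le> card W"
    "W \<subseteq> cfun.span (S \<union> B)" by auto
  obtain C where C: "orthonormal_set (S \<union> B \<union> C)" "(S \<union> B) \<inter> C = {}" "finite C" "card C \<le> 1"
    "f \<in> cfun.span (S \<union> B \<union> C)"
    using Gram_Schmidt_step[OF B(1), of f] insert.prems by auto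
  have "card (B \<union> C) \<le> card (insert f W)"
    using card_Un_le[of B C] B(4) C(4) insert.hyps by simp
  moreover have "W \<subseteq> cfun.span (S \<union> (B \<union> C))"
    using B(5) cfun.span_mono[of "S \<union> B" "S \<union> (B \<union> C)"] by blast
  ultimately show ?case using B C by (intro exI[of _ "B \<union> C"]) (auto simp: Un_assoc)
qed

end

section \<open>Choosing sampling points\<close>

context rkhs
begin

text \<open>Allowing fewer than \<open>N\<close> points makes the property monotone in
  \<open>N\<close>; the square makes \<open>s\<close> itself a bound for errors in the sup
  norm.\<close>

definition sampled_power :: "nat \<Rightarrow> real \<Rightarrow> bool" where
  "sampled_power N s \<longleftrightarrow> (\<exists>X S. finite X \<and> X \<subseteq> D \<and> card X \<le> N \<and> orthonormal_set S \<and>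
     S \<subseteq> cfun.span (ker ` X) \<and> (\<forall>x\<in>D. power2_fun S x \<le> s\<^sup>2))"

text \<open>The residual of the kernel section represents the error functional of the projection at
  \<open>x\<close>, so Cauchy-Schwarz bounds the error by the square root of the power
  function.\<close>

lemma ip_residual:
  assumes "orthonormal_set S" "f \<in> H" "x \<in> D"
  shows "ip f (ker x - proj S (ker x)) = f x - (\<Sum>q\<in>S. ip f q * q x)"
proof -
  have "ip f (proj S (ker x)) = (\<Sum>q\<in>S. ip f (cscale (ip (ker x) q) q))"
    unfolding proj_def
    using orthonormal_setD[OF assms(1)] assms(2) by (intro form.sum_right) (auto intro: form.mem)
  also have "\<dots> = (\<Sum>q\<in>S. ip f q * q x)"
    using orthonormal_setD[OF assms(1)] assms(2,3)
    by (intro sum.cong refl) (auto simp: form.scale_right ip_ker_cnj)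
  finally show ?thesis
    using assms by (simp add: form.diff_right proj_mem kernel_in reproducing[symmetric])
qed

lemma approximation_error_le:
  assumes "orthonormal_set S" "f \<in> H" "x \<in> D"
  shows "cmod (f x - (\<Sum>q\<in>S. ip f q * q x)) \<le> sqrt (sqn f) * sqrt (power2_fun S x)"
  unfolding ip_residual[OF assms, symmetric] power2_fun_eq[OF assms(1,3)]
  by (intro form.cmod_le assms form.mem proj_mem kernel_in)

text \<open>Being orthogonal to \<open>S\<close>, \<open>q\<close> is expanded through
  \<open>B\<close> alone, with an error of at most \<open>d\<close> at \<open>x\<close>. The squared
  values of \<open>B\<close> at \<open>x\<close> sum to at most the square of \<open>s\<close>,
  because adding \<open>B\<close> to \<open>S\<close> cannot make the power function
  negative.\<close>

lemma orthonormal_union_bound: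
  assumes SB: "orthonormal_set (S \<union> B)" "S \<inter> B = {}" and q: "orthonormal_set (insert q S)" "q \<notin> S"
    and x: "x \<in> D" and d: "power2_fun (S \<union> B) x \<le> d\<^sup>2" "0 \<le> d"
    and s: "power2_fun S x \<le> s\<^sup>2" "0 \<le> s"
  shows "cmod (q x) \<le> s * sqrt (\<Sum>b\<in>B. (cmod (ip q b))\<^sup>2) + d"
proof -
  have fin: "finite S" "finite B" using orthonormal_setD(1)[OF SB(1)] by auto
  have qH: "q \<in> H" and qq: "ip q q = 1" and qS: "\<And>r. r \<in> S \<Longrightarrow> ip q r = 0"
    using q orthonormal_setD[OF q(1)] by auto
  have "(\<Sum>r\<in>S \<union> B. ip q r * r x) = (\<Sum>r\<in>S. ip q r * r x) + (\<Sum>r\<in>B. ip q r * r x)"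
    by (rule sum.union_disjoint[OF fin SB(2)])
  then have split: "(\<Sum>r\<in>S \<union> B. ip q r * r x) = (\<Sum>r\<in>B. ip q r * r x)" by (simp add: qS)
  have "cmod (q x - (\<Sum>r\<in>S \<union> B. ip q r * r x)) \<le> sqrt (sqn q) * sqrt (power2_fun (S \<union> B) x)"
    by (rule approximation_error_le[OF SB(1) qH x])
  also have "\<dots> \<le> d" using d real_sqrt_le_mono[OF d(1)] by (simp add: qq)
  finally have 1: "cmod (q x - (\<Sum>r\<in>B. ip q r * r x)) \<le> d" by (simp only: split)
  have "(\<Sum>r\<in>S \<union> B. (cmod (r x))\<^sup>2) = (\<Sum>r\<in>S. (cmod (r x))\<^sup>2) + (\<Sum>r\<in>B. (cmod (r x))\<^sup>2)"
    by (rule sum.union_disjoint[OF fin SB(2)])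
  with power2_fun_nonneg[OF SB(1) x] s(1) have Bx: "(\<Sum>r\<in>B. (cmod (r x))\<^sup>2) \<le> s\<^sup>2"
    unfolding power2_fun_def by linarith
  have "cmod (\<Sum>r\<in>B. ip q r * r x) \<le> (\<Sum>r\<in>B. \<bar>cmod (ip q r)\<bar> * \<bar>cmod (r x)\<bar>)"
    by (rule order.trans[OF norm_sum]) (simp add: norm_mult)
  also have "\<dots> \<le> L2_set (\<lambda>r. cmod (ip q r)) B * L2_set (\<lambda>r. cmod (r x)) B"
    by (rule L2_set_mult_ineq)
  also have "\<dots> \<le> L2_set (\<lambda>r. cmod (ip q r)) B * s"
    using real_sqrt_le_mono[OF Bx] s(2) by (intro mult_left_mono) (auto simp: L2_set_def sum_nonneg)
  finally have "cmod (\<Sum>r\<in>B. ip q r * r x) \<le> s * sqrt (\<Sum>b\<in>B. (cmod (ip q b))\<^sup>2)"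
    by (simp add: L2_set_def mult.commute)
  moreover have "cmod (q x) \<le> cmod (q x - (\<Sum>r\<in>B. ip q r * r x)) + cmod (\<Sum>r\<in>B. ip q r * r x)"
    using norm_triangle_ineq[of "q x - (\<Sum>r\<in>B. ip q r * r x)" "\<Sum>r\<in>B. ip q r * r x"] by simp
  ultimately show ?thesis using 1 by linarith
qed

lemma orthonormal_subset: "orthonormal_set S \<Longrightarrow> T \<subseteq> S \<Longrightarrow> orthonormal_set T"
  unfolding orthonormal_set_def by (meson finite_subset order.trans subsetD)

text \<open>Either some stage already has a small power function, or the next point can be taken
  where it exceeds the square of \<delta>; the normalized residual is then large at that very
  point.\<close>

lemma greedy_extension:
  assumes X: "finite X" "X \<subseteq> D" and S: "orthonormal_set S" "S \<subseteq> cfun.span (ker ` X)" and "0 \<le> \<delta>"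
  shows "sampled_power (card X + n) \<delta> \<or>
    (\<exists>Y Q. finite Y \<and> Y \<subseteq> D \<and> card Y \<le> card X + n \<and> orthonormal_set (S \<union> Q) \<and> S \<inter> Q = {} \<and>
       S \<union> Q \<subseteq> cfun.span (ker ` Y) \<and> card Q = n \<and> (\<forall>q\<in>Q. \<exists>x\<in>D. \<delta> < cmod (q x)))"
proof (induction n)
  case 0
  show ?case using X S by (intro disjI2 exI[of _ X] exI[of _ "{}"]) auto
next
  case (Suc n)
  from Suc.IH consider "sampled_power (card X + n) \<delta>"
    | Y Q where "finite Y" "Y \<subseteq> D" "card Y \<le> card X + n" "orthonormal_set (S \<union> Q)" "S \<inter> Q = {}"
       "S \<union> Q \<subseteq> cfun.span (ker ` Y)" "card Q = n" "\<forall>q\<in>Q. \<exists>x\<in>D. \<delta> < cmod (q x)"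
    by blast
  then show ?case
  proof cases
    case 1
    then have "sampled_power (card X + Suc n) \<delta>"
      unfolding sampled_power_def by (metis add_Suc_right le_SucI)
    then show ?thesis ..
  next
    case 2
    show ?thesis
    proof (cases "\<forall>x\<in>D. power2_fun (S \<union> Q) x \<le> \<delta>\<^sup>2")
      case True
      have "card Y \<le> card X + Suc n" using 2(3) by simp
      then have "sampled_power (card X + Suc n) \<delta>"
        unfolding sampled_power_def using True 2 by blast
      then show ?thesis ..
    next
      case False
      then obtain x where x: "x \<in> D" "\<delta>\<^sup>2 < power2_fun (S \<union> Q) x" by force
      let ?r = "ker x - proj (S \<union> Q) (ker x)"
      have r: "?r \<in> H" using 2(4) x by (intro form.mem proj_mem kernel_in)
      have sq: "\<delta>\<^sup>2 < sqn ?r" using x 2(4) by (simp add: power2_fun_eq)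
      have pos: "0 < sqn ?r" using sq by (meson le_less_trans zero_le_power2)
      then have "?r \<noteq> 0" using sqn_zero_iff[OF r] by fastforce
      note n = sqn_normalized[OF r this]
      define q where "q = cscale (of_real (1 / sqrt (sqn ?r))) ?r"
      have qH: "q \<in> H" unfolding q_def using r by (rule form.mem_scale)
      have orth: "ip q g = 0" if "g \<in> S \<union> Q" for g
      proof -
        have "g \<in> H" using that 2(4) orthonormal_setD by blast
        then have "ip q g = of_real (1 / sqrt (sqn ?r)) * ip ?r g"
          unfolding q_def by (rule form.scale_left[OF r])
        then show ?thesis using ip_sub_proj[OF 2(4) kernel_in[OF x(1)] that] by simp
      qed
      have n1: "sqn q = 1" using n(1) by (simp add: q_def)
      note ins = orthonormal_set_insert[OF 2(4) qH orth n1]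
      \<comment> \<open>By the reproducing property and orthogonality, the residual takes the value
        \<open>ip ?r ?r\<close> at \<open>x\<close>. After normalization \<open>q x\<close> is
        therefore the norm of the residual.\<close>
      have "ip ?r ?r = q x * of_real (sqrt (sqn ?r))"
      proof -
        have "ip ?r (ker x) = ip ?r ?r + ip ?r (proj (S \<union> Q) (ker x))"
          using form.diff_right[OF kernel_in[OF x(1)] proj_mem[OF 2(4)] r, of "ker x"] by simp
        then have "ip ?r ?r = ip ?r (ker x)"
          using ip_sub_proj_span[OF 2(4) kernel_in[OF x(1)] proj_span, of "ker x"] by simp
        also have "\<dots> = ?r x" using reproducing[OF r x(1)] by simp
        also have "\<dots> = q x * of_real (sqrt (sqn ?r))"
          using fun_cong[OF n(2), of x] by (simp only: q_def cscale_apply mult.commute)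
        finally show ?thesis .
      qed
      then have "of_real (sqn ?r) = q x * of_real (sqrt (sqn ?r))"
        using form.self_real[OF r] by simp
      then have "cmod (of_real (sqn ?r)) = cmod (q x) * sqrt (sqn ?r)"
        using pos by (simp only: norm_mult norm_of_real) simp
      then have eq: "cmod (q x) * sqrt (sqn ?r) = sqrt (sqn ?r) * sqrt (sqn ?r)"
        using pos by (simp only: norm_of_real) simp
      have nz: "sqrt (sqn ?r) \<noteq> 0" using pos by simp
      have "cmod (q x) = sqrt (sqn ?r)" by (rule mult_right_cancel[OF nz, THEN iffD1, OF eq])
      moreover have "\<delta> < sqrt (sqn ?r)" using sq assms(5) by (simp add: real_less_rsqrt)
      ultimately have big: "\<delta> < cmod (q x)" by simp
      let ?Y = "insert x Y"
      have mono: "cfun.span (ker ` Y) \<subseteq> cfun.span (ker ` ?Y)" by (intro cfun.span_mono) auto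
      have "ker x \<in> cfun.span (ker ` ?Y)" by (intro cfun.span_base) auto
      moreover have "proj (S \<union> Q) (ker x) \<in> cfun.span (ker ` ?Y)"
        using proj_span[of "S \<union> Q" "ker x"] 2(6) mono
        by (meson cfun.span_minimal cfun.subspace_span subset_trans subsetD)
      ultimately have qspan: "q \<in> cfun.span (ker ` ?Y)"
        unfolding q_def by (intro cfun.span_scale cfun.span_diff)
      have finQ: "finite Q" using orthonormal_setD(1)[OF 2(4)] by auto
      have "card ?Y \<le> card X + Suc n" using 2(1,3) by (simp add: card_insert_if)
      then show ?thesis
        using 2 ins x big qspan mono finQ
        by (intro disjI2 exI[of _ ?Y] exI[of _ "insert q Q"]) auto
    qed
  qed
qed

text \<open>Double counting of the squares of \<open>cmod (ip q b)\<close> over \<open>n\<close> new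
  functions \<open>q\<close> and at most \<open>m\<close> directions \<open>b\<close>: a large value
  of \<open>q\<close> forces a row sum above \<open>m / n\<close>, while each column sum is at most
  1.\<close>

lemma sampled_power_extend:
  assumes sp: "sampled_power N s" "0 \<le> s"
    and E: "orthonormal_set E" "card E \<le> m" "\<And>x. x \<in> D \<Longrightarrow> power2_fun E x \<le> d\<^sup>2" "0 \<le> d"
    and n: "n \<ge> 1"
  shows "sampled_power (N + n) (s * sqrt (m / n) + d)"
proof (rule ccontr)
  assume neg: "\<not> ?thesis"
  define \<delta> where "\<delta> = s * sqrt (m / n) + d"
  have \<delta>: "\<delta> \<ge> 0" unfolding \<delta>_def using sp E by simp
  obtain X S where X: "finite X" "X \<subseteq> D" "card X \<le> N" and S: "orthonormal_set S"
    "S \<subseteq> cfun.span (ker ` X)" "\<And>x. x \<in> D \<Longrightarrow> power2_fun S x \<le> s\<^sup>2"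
    using sp(1) unfolding sampled_power_def by blast
  have "\<not> sampled_power (card X + n) \<delta>"
  proof
    assume "sampled_power (card X + n) \<delta>"
    then have "sampled_power (N + n) \<delta>"
      using X(3) unfolding sampled_power_def by (meson add_le_mono1 order.trans)
    with neg show False by (simp add: \<delta>_def)
  qed
  with greedy_extension[OF X(1,2) S(1,2) \<delta>, of n] obtain Q where
    Q: "orthonormal_set (S \<union> Q)" "S \<inter> Q = {}" "card Q = n" "\<And>q. q \<in> Q \<Longrightarrow> \<exists>x\<in>D. \<delta> < cmod (q x)"
    by blast
  have finQ: "finite Q" using orthonormal_setD(1)[OF Q(1)] by auto
  \<comment> \<open>\<open>B\<close> collects what \<open>E\<close> adds to \<open>S\<close>. The
    power function of \<open>S \<union> B\<close> is at most that of \<open>E\<close>, and the new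
    functions are orthogonal to \<open>S\<close>, so only the at most \<open>m\<close> elements of
    \<open>B\<close> count.\<close>
  obtain B where B: "orthonormal_set (S \<union> B)" "S \<inter> B = {}" "finite B" "card B \<le> card E"
    "E \<subseteq> cfun.span (S \<union> B)"
    using Gram_Schmidt[of E S] E(1) S(1) orthonormal_setD[OF E(1)] by blast
  have less: "real m / n < (\<Sum>b\<in>B. (cmod (ip q b))\<^sup>2)" if q: "q \<in> Q" for q
  proof -
    obtain x where x: "x \<in> D" "\<delta> < cmod (q x)" using Q(4)[OF q] by blast
    have "power2_fun (S \<union> B) x \<le> power2_fun E x"
      by (rule power2_fun_mono[OF E(1) B(1,5) x(1)])
    with E(3)[OF x(1)] have pd: "power2_fun (S \<union> B) x \<le> d\<^sup>2" by linarith
    have "orthonormal_set (insert q S)" "q \<notin> S"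
      using q Q(2) by (auto intro: orthonormal_subset[OF Q(1)])
    from orthonormal_union_bound[OF B(1,2) this x(1) pd E(4) S(3)[OF x(1)] sp(2)] x(2)
    have "s * sqrt (m / n) < s * sqrt (\<Sum>b\<in>B. (cmod (ip q b))\<^sup>2)"
      unfolding \<delta>_def by linarith
    then have "sqrt (m / n) < sqrt (\<Sum>b\<in>B. (cmod (ip q b))\<^sup>2)"
      using sp(2) by (rule mult_left_less_imp_less)
    then show ?thesis by simp
  qed
  have Qn: "Q \<noteq> {}" using Q(3) n by auto
  have "real m = (\<Sum>q\<in>Q. real m / n)" using Q(3) n by simp
  also have "\<dots> < (\<Sum>q\<in>Q. \<Sum>b\<in>B. (cmod (ip q b))\<^sup>2)" by (rule sum_strict_mono[OF finQ Qn less])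
  also have "\<dots> = (\<Sum>b\<in>B. \<Sum>q\<in>Q. (cmod (ip q b))\<^sup>2)" by (rule sum.swap)
  also have "\<dots> \<le> (\<Sum>b\<in>B. 1)"
  proof (rule sum_mono)
    fix b assume b: "b \<in> B"
    then have bH: "b \<in> H" and bb: "ip b b = 1" using orthonormal_setD[OF B(1)] by auto
    have QH: "Q \<subseteq> H" using orthonormal_setD[OF Q(1)] by auto
    have "(\<Sum>q\<in>Q. (cmod (ip q b))\<^sup>2) = (\<Sum>q\<in>Q. (cmod (ip b q))\<^sup>2)"
      using QH bH by (intro sum.cong refl) (metis complex_mod_cnj form.conj_sym subsetD)
    also have "\<dots> \<le> sqn b" by (intro Bessel orthonormal_subset[OF Q(1)] bH) auto
    finally show "(\<Sum>q\<in>Q. (cmod (ip q b))\<^sup>2) \<le> 1" by (simp add: bb)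
  qed
  also have "\<dots> \<le> real m" using B(4) E(2) by simp
  finally show False by simp
qed

lemma sampled_power_start:
  assumes "\<And>x. x \<in> D \<Longrightarrow> sqn (ker x) \<le> s\<^sup>2"
  shows "sampled_power N s"
  unfolding sampled_power_def using assms
  by (intro exI[of _ "{}"]) (auto simp: orthonormal_set_def power2_fun_def)

lemma sampled_power_mono: "sampled_power N s \<Longrightarrow> 0 \<le> s \<Longrightarrow> s \<le> t \<Longrightarrow> N \<le> M \<Longrightarrow> sampled_power M t"
  unfolding sampled_power_def by (meson order.trans power_mono)

text \<open>In the inductive step the dimension \<open>m = 2\<^sup>k\<^sup>-\<^sup>2\<^sup>l\<close> is chosen so much smaller than the number
  \<open>2\<^sup>k\<close> of new points that the power function decreases by the factor \<open>2\<^sup>-\<^sup>l \<le> 2\<^sup>-\<^sup>\<alpha> / 2\<close>;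
  the other half of the error budget \<open>2\<^sup>-\<^sup>\<alpha>\<close> is left for \<open>d\<close>.\<close>

lemma sampled_power_dyadic:
  assumes bound: "\<And>x. x \<in> D \<Longrightarrow> sqn (ker x) \<le> s0\<^sup>2" "0 \<le> s0" and "0 < \<alpha>" "0 \<le> C"
    and E: "\<And>j. orthonormal_set (E j)" "\<And>j. card (E j) \<le> 2 ^ j"
      "\<And>j x. x \<in> D \<Longrightarrow> power2_fun (E j) x \<le> (C * 2 powr (- \<alpha> * real j))\<^sup>2"
  obtains C' where "C' > 0" "\<And>k. sampled_power (2 ^ k) (C' * 2 powr (- \<alpha> * real k))"
proof -
  define l where "l = nat \<lceil>\<alpha>\<rceil> + 1"
  have l: "real l \<ge> \<alpha> + 1" unfolding l_def using assms(3) by linarith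
  \<comment> \<open>The first summand covers the initial range, where the trivial bound
    \<open>s0\<close> is used; the second lets \<open>d\<close> fit into half of the budget; the 1
    makes \<open>C'\<close> positive.\<close>
  define C' where "C' = s0 * 2 powr (\<alpha> * real (2 * l)) + 2 * C * 2 powr (\<alpha> * real (2 * l) + \<alpha>) + 1"
  have C': "C' > 0" "s0 * 2 powr (\<alpha> * real (2 * l)) \<le> C'" "2 * C * 2 powr (\<alpha> * real (2 * l) + \<alpha>) \<le> C'"
    unfolding C'_def using assms by (auto intro!: add_nonneg_pos add_nonneg_nonneg)
  have "sampled_power (2 ^ k) (C' * 2 powr (- \<alpha> * real k))" for k
  proof (induction k)
    case 0
    have "s0 * 1 \<le> s0 * 2 powr (\<alpha> * real (2 * l))"
      using assms by (intro mult_left_mono) (auto intro!: ge_one_powr_ge_zero)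
    with C'(2) have "s0 \<le> C'" by simp
    then show ?case using sampled_power_mono[OF sampled_power_start[OF bound(1), of 1] bound(2), where M = 1 and t = C']
      by simp
  next
    case (Suc k)
    show ?case
    \<comment> \<open>Below \<open>2 * l\<close> there is no exponent \<open>k - 2 * l\<close> to
      use, but the trivial bound \<open>s0\<close> suffices.\<close>
    proof (cases "k < 2 * l")
      case True
      have "s0 * 1 \<le> s0 * 2 powr (\<alpha> * real (2 * l) + - \<alpha> * real (Suc k))"
        using assms True by (intro mult_left_mono ge_one_powr_ge_zero) (auto simp flip: right_diff_distrib)
      also have "\<dots> = s0 * 2 powr (\<alpha> * real (2 * l)) * 2 powr (- \<alpha> * real (Suc k))"
        by (simp only: powr_add mult.assoc)
      also have "\<dots> \<le> C' * 2 powr (- \<alpha> * real (Suc k))" using C'(2) by (intro mult_right_mono) auto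
      finally have "s0 \<le> C' * 2 powr (- \<alpha> * real (Suc k))" by simp
      from sampled_power_mono[OF sampled_power_start[OF bound(1), of "2 ^ Suc k"] bound(2) this, where M = "2 ^ Suc k"]
      show ?thesis by simp
    next
      case False
      define j where "j = k - 2 * l"
      have k: "k = j + 2 * l" using False by (simp add: j_def)
      let ?s = "C' * 2 powr (- \<alpha> * real k)" and ?d = "C * 2 powr (- \<alpha> * real j)"
      have "sampled_power (2 ^ k + 2 ^ k) (?s * sqrt (real (2 ^ j) / real (2 ^ k)) + ?d)"
        using sampled_power_extend[OF Suc.IH _ E(1)[of j] E(2)[of j] E(3)[of _ j], of "2 ^ k"] C'(1) assms(4)
        by simp
      moreover have "?s * sqrt (real (2 ^ j) / real (2 ^ k)) + ?d \<le> C' * 2 powr (- \<alpha> * real (Suc k))"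
      proof -
        have "real (2 ^ j) / real (2 ^ k) = (1 / 2 ^ l)\<^sup>2"
          by (simp add: k power_add power_mult power2_eq_square field_simps mult_2)
        then have "sqrt (real (2 ^ j) / real (2 ^ k)) = 1 / 2 ^ l"
          by (simp only: real_sqrt_abs) simp
        also have "\<dots> = 2 powr (- real l)"
          by (simp add: powr_minus powr_realpow field_simps)
        also have "\<dots> \<le> 2 powr (- \<alpha> - 1)" using l by (intro powr_mono) auto
        also have "\<dots> = 2 powr (- \<alpha>) / 2" by (simp add: powr_diff)
        finally have "?s * sqrt (real (2 ^ j) / real (2 ^ k)) \<le> ?s * (2 powr (- \<alpha>) / 2)"
          using C'(1) by (intro mult_left_mono) auto
        also have "\<dots> = C' * 2 powr (- \<alpha> * real (Suc k)) / 2"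
          by (simp add: powr_add[symmetric] algebra_simps)
        finally have 1: "?s * sqrt (real (2 ^ j) / real (2 ^ k)) \<le> C' * 2 powr (- \<alpha> * real (Suc k)) / 2" .
        have "- \<alpha> * real j = (\<alpha> * real (2 * l) + \<alpha>) + (- \<alpha> * real (Suc k))"
          by (simp add: k algebra_simps)
        then have "2 powr (- \<alpha> * real j) = 2 powr (\<alpha> * real (2 * l) + \<alpha>) * 2 powr (- \<alpha> * real (Suc k))"
          by (simp only: powr_add)
        then have "2 * ?d = 2 * C * 2 powr (\<alpha> * real (2 * l) + \<alpha>) * 2 powr (- \<alpha> * real (Suc k))" by simp
        also have "\<dots> \<le> C' * 2 powr (- \<alpha> * real (Suc k))" using C'(3) by (intro mult_right_mono) auto
        finally show ?thesis using 1 by linarith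
      qed
      moreover have "0 \<le> ?s * sqrt (real (2 ^ j) / real (2 ^ k)) + ?d" using C'(1) assms(4) by simp
      ultimately show ?thesis using sampled_power_mono[where M = "2 ^ Suc k"] by (simp add: mult_2)
    qed
  qed
  with C'(1) that show thesis by blast
qed

end

section \<open>Upper bounds for sampling and approximation numbers\<close>

text \<open>Coefficients are wanted per index although \<open>g\<close> may repeat values, as it
  does for padded sampling points. They sit on a subset \<open>J\<close> where \<open>g\<close> is
  injective; the other indices get 0.\<close>

lemma span_image_finite:
  assumes "finite I" "f \<in> cfun.span (g ` I)"
  obtains c where "f = (\<Sum>i\<in>I. cscale (c i) (g i))"
proof -
  obtain J where J: "J \<subseteq> I" "inj_on g J" "g ` I = g ` J"
    using subset_image_inj[of "g ` I" g I] by auto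
  have "finite (g ` J)" using assms(1) J(1) finite_subset by blast
  then obtain u where "f = (\<Sum>v\<in>g ` J. cscale (u v) v)"
    using assms(2) unfolding J(3) by (auto simp: cfun.span_finite)
  also have "\<dots> = (\<Sum>i\<in>J. cscale (u (g i)) (g i))" by (simp add: sum.reindex[OF J(2)])
  also have "\<dots> = (\<Sum>i\<in>I. cscale (if i \<in> J then u (g i) else 0) (g i))"
    using assms(1) J(1) by (intro sum.mono_neutral_cong_left) (auto simp: cfun.scale_zero_left)
  finally show thesis by (rule that)
qed

lemma sup_norm_le: "0 \<le> M \<Longrightarrow> (\<And>x. x \<in> D \<Longrightarrow> cmod (f x) \<le> M) \<Longrightarrow> sup_norm D f \<le> ennreal M"
  unfolding sup_norm_def by (intro SUP_least ennreal_leI) auto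

context rkhs
begin

lemma value_le: "f \<in> H \<Longrightarrow> x \<in> D \<Longrightarrow> cmod (f x) \<le> sqrt (sqn f) * sqrt (sqn (ker x))"
  using form.cmod_le[of f "ker x"] by (simp add: reproducing[symmetric] kernel_in)

lemma value_le_bound:
  assumes "\<And>x. x \<in> D \<Longrightarrow> sqn (ker x) \<le> s0\<^sup>2" "0 \<le> s0" "f \<in> H" "x \<in> D"
  shows "cmod (f x) \<le> s0 * sqrt (sqn f)"
proof -
  have "sqrt (sqn (ker x)) \<le> s0" using real_sqrt_le_mono[OF assms(1)[OF assms(4)]] assms(2) by simp
  then have "sqrt (sqn f) * sqrt (sqn (ker x)) \<le> sqrt (sqn f) * s0"
    by (intro mult_left_mono) (auto simp: ip_nonneg assms)
  with value_le[OF assms(3,4)] show ?thesis by (simp add: mult.commute)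
qed

lemma mem_l_infinity:
  assumes "\<And>x. x \<in> D \<Longrightarrow> sqn (ker x) \<le> s0\<^sup>2" "0 \<le> s0" "f \<in> H"
  shows "f \<in> l_infinity D"
proof -
  have "sup_norm D f \<le> ennreal (s0 * sqrt (sqn f))"
    using assms by (intro sup_norm_le value_le_bound) (auto simp: ip_nonneg)
  also have "\<dots> < \<infinity>" by simp
  finally show ?thesis unfolding l_infinity_def using vanish[OF assms(3)] by simp
qed

lemma sup_norm_sub_proj_le:
  assumes S: "orthonormal_set S" "\<And>x. x \<in> D \<Longrightarrow> power2_fun S x \<le> s\<^sup>2" "0 \<le> s"
    and f: "f \<in> unit_ball H ip"
  shows "sup_norm D (f - proj S f) \<le> ennreal s"
proof (rule sup_norm_le[OF S(3)])
  fix x assume x: "x \<in> D"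
  have fH: "f \<in> H" and f1: "sqrt (sqn f) \<le> 1" using f by (auto simp: unit_ball_def ip_norm_def)
  have "sqrt (sqn f) * sqrt (power2_fun S x) \<le> 1 * s"
    using f1 real_sqrt_le_mono[OF S(2)[OF x]] S(3) power2_fun_nonneg[OF S(1) x]
    by (intro mult_mono) auto
  with approximation_error_le[OF S(1) fH x] show "cmod ((f - proj S f) x) \<le> s"
    by (simp add: proj_def sum_fun_apply cscale_apply)
qed

lemma sampling_number_le:
  assumes bd: "\<And>x. x \<in> D \<Longrightarrow> sqn (ker x) \<le> s0\<^sup>2" "0 \<le> s0" and "D \<noteq> {}"
    and sp: "sampled_power n s" "0 \<le> s"
  shows "sampling_number D H ip n \<le> ennreal s"
proof -
  obtain X S where X: "finite X" "X \<subseteq> D" "card X \<le> n" and S: "orthonormal_set S"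
    "S \<subseteq> cfun.span (ker ` X)" "\<And>x. x \<in> D \<Longrightarrow> power2_fun S x \<le> s\<^sup>2"
    using sp(1) unfolding sampled_power_def by blast
  obtain h where h: "bij_betw h {0..<card X} X" using ex_bij_betw_nat_finite[OF X(1)] by blast
  obtain x0 where x0: "x0 \<in> D" using assms(3) by blast
  \<comment> \<open>Exactly \<open>n\<close> points are required, so the enumeration of
    \<open>X\<close> is padded with an arbitrary point of \<open>D\<close>.\<close>
  define x where "x i = (if i < card X then h i else x0)" for i
  have xD: "x i \<in> D" for i
    using h X(2) x0 unfolding x_def bij_betw_def by auto
  have "X \<subseteq> x ` {..<n}"
  proof
    fix y assume "y \<in> X"
    then obtain i where "i < card X" "y = h i" using h unfolding bij_betw_def by force
    then show "y \<in> x ` {..<n}" using X(3) by (auto simp: x_def intro!: image_eqI[of _ _ i])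
  qed
  then have "ker ` X \<subseteq> (\<lambda>i. ker (x i)) ` {..<n}" by auto
  then have sub: "S \<subseteq> cfun.span ((\<lambda>i. ker (x i)) ` {..<n})"
    using S(2) cfun.span_mono by blast
  have "\<exists>c. q = (\<Sum>i<n. cscale (c i) (ker (x i)))" if "q \<in> S" for q
    using span_image_finite[of "{..<n}" q "\<lambda>i. ker (x i)"] sub that by blast
  then obtain a where a: "\<And>q. q \<in> S \<Longrightarrow> q = (\<Sum>i<n. cscale (a q i) (ker (x i)))" by metis
  \<comment> \<open>This is the projection rewritten in terms of samples, but defined on all tuples.
    The conjugates appear because \<open>ip\<close> is conjugate-linear in its second argument,
    where the kernel sections stand.\<close>
  define R where "R c = (\<Sum>q\<in>S. cscale (\<Sum>i<n. cnj (a q i) * c i) q)" for c :: "nat \<Rightarrow> complex"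
  have coeff: "ip f q = (\<Sum>i<n. cnj (a q i) * f (x i))" if f: "f \<in> H" and q: "q \<in> S" for f q
  proof -
    have "ip f q = ip f (\<Sum>i<n. cscale (a q i) (ker (x i)))" using a[OF q] by simp
    also have "\<dots> = (\<Sum>i<n. ip f (cscale (a q i) (ker (x i))))"
      using xD f by (intro form.sum_right) (auto intro: form.mem kernel_in)
    also have "\<dots> = (\<Sum>i<n. cnj (a q i) * f (x i))"
      using xD f by (intro sum.cong refl) (simp add: form.scale_right kernel_in reproducing[symmetric])
    finally show ?thesis .
  qed
  have Rproj: "R (\<lambda>i. if i < n then f (x i) else 0) = proj S f" if "f \<in> H" for f
    unfolding R_def proj_def using coeff[OF that] by (intro sum.cong refl) simp
  have RH: "R c \<in> H" for c
    unfolding R_def using orthonormal_setD[OF S(1)] by (intro form.mem) auto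
  have "linear_map_on (complex_tuples n) R"
    unfolding linear_map_on_def
    by (auto simp: R_def fun_eq_iff sum_fun_apply cscale_apply distrib_left distrib_right sum.distrib
      sum_distrib_left sum_distrib_right mult_ac)
  moreover have "R ` complex_tuples n \<subseteq> l_infinity D"
    using mem_l_infinity[OF bd RH] by auto
  ultimately have R: "R \<in> {R. linear_map_on (complex_tuples n) R \<and> R ` complex_tuples n \<subseteq> l_infinity D}"
    by blast
  have x: "x \<in> {x. \<forall>i<n. x i \<in> D}" using xD by simp
  show ?thesis
    unfolding sampling_number_def
  proof (rule INF_lower2[OF x], rule INF_lower2[OF R], rule SUP_least)
    fix f assume f: "f \<in> unit_ball H ip"
    then have "f \<in> H" by (simp add: unit_ball_def)
    then show "sup_norm D (f - R (\<lambda>i. if i < n then f (x i) else 0)) \<le> ennreal s"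
      using sup_norm_sub_proj_le[OF S(1,3) sp(2) f] by (simp only: Rproj)
  qed
qed

lemma orthonormal_independent:
  assumes "orthonormal_set S"
  shows "\<not> cfun.dependent S"
proof
  assume "cfun.dependent S"
  then obtain T u v where T: "finite T" "T \<subseteq> S" "(\<Sum>w\<in>T. cscale (u w) w) = 0" "v \<in> T" "u v \<noteq> 0"
    unfolding cfun.dependent_explicit by blast
  have ON: "orthonormal_set T" by (rule orthonormal_subset[OF assms T(2)])
  from ip_combination_left[OF ON T(4), of u] show False
    using T orthonormal_setD[OF ON] by (simp add: form.zero_left)
qed

lemma proj_linear:
  assumes "orthonormal_set S"
  shows "linear_map_on H (proj S)"
proof -
  have "proj S (f + g) = proj S f + proj S g" if "f \<in> H" "g \<in> H" for f g
    unfolding proj_def sum.distrib[symmetric] using that orthonormal_setD[OF assms]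
    by (intro sum.cong refl) (simp add: form.add_left cfun.scale_left_distrib)
  moreover have "proj S (cscale c f) = cscale c (proj S f)" if "f \<in> H" for f c
    unfolding proj_def cfun.scale_sum_right using that orthonormal_setD[OF assms]
    by (intro sum.cong refl) (simp add: form.scale_left)
  ultimately show ?thesis unfolding linear_map_on_def by blast
qed

text \<open>The projection used for sampling is reused. Its rank is \<open>card S\<close>, at most
  \<open>N\<close> because \<open>S\<close> is independent in the span of at most \<open>N\<close>
  sections; \<open>N < n\<close> matches the strict bound on the rank.\<close>

lemma approx_number_le:
  assumes bd: "\<And>x. x \<in> D \<Longrightarrow> sqn (ker x) \<le> s0\<^sup>2" "0 \<le> s0"
    and sp: "sampled_power N s" "0 \<le> s" and "N < n"
  shows "approx_number D H ip n \<le> ennreal s"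
proof -
  obtain X S where X: "finite X" "X \<subseteq> D" "card X \<le> N" and S: "orthonormal_set S"
    "S \<subseteq> cfun.span (ker ` X)" "\<And>x. x \<in> D \<Longrightarrow> power2_fun S x \<le> s\<^sup>2"
    using sp(1) unfolding sampled_power_def by blast
  have ind: "\<not> cfun.dependent S" by (rule orthonormal_independent[OF S(1)])
  have "card S \<le> card (ker ` X)"
    using cfun.independent_span_bound[OF _ ind S(2)] X(1) by blast
  also have "\<dots> \<le> N" using card_image_le[OF X(1), of ker] X(3) by linarith
  finally have cS: "card S < n" using assms(5) by simp
  have "proj S ` H = cfun.span S"
  proof
    show "cfun.span S \<subseteq> proj S ` H"
    proof
      fix f assume f: "f \<in> cfun.span S"
      then have "f \<in> H" using form.mem_span[OF orthonormal_setD(2)[OF S(1)]] by blast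
      then show "f \<in> proj S ` H" using span_coefficients[OF S(1) f] by blast
    qed
  qed (use proj_span in blast)
  then have rk: "rank_less H (proj S) n"
    unfolding rank_less_def using cS ind orthonormal_setD(1)[OF S(1)] by metis
  have bounded: "sup_norm D (proj S f) \<le> ennreal (s0 * ip_norm ip f)" if f: "f \<in> H" for f
  proof (rule sup_norm_le)
    show "0 \<le> s0 * ip_norm ip f" using bd(2) f by (simp add: ip_norm_def ip_nonneg)
    fix x assume x: "x \<in> D"
    have "sqn (proj S f) \<le> sqn f"
      using Bessel[OF S(1) f] sqn_combination[OF S(1), of "ip f"] unfolding proj_def by linarith
    then have "s0 * sqrt (sqn (proj S f)) \<le> s0 * sqrt (sqn f)"
      using bd(2) by (intro mult_left_mono real_sqrt_le_mono)
    with value_le_bound[OF bd proj_mem[OF S(1)] x, of f]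
    show "cmod (proj S f x) \<le> s0 * ip_norm ip f" unfolding ip_norm_def by linarith
  qed
  have "proj S \<in> {A. linear_map_on H A \<and> A ` H \<subseteq> l_infinity D \<and>
      (\<exists>C::real. \<forall>f\<in>H. sup_norm D (A f) \<le> ennreal (C * ip_norm ip f)) \<and> rank_less H A n}"
    using proj_linear[OF S(1)] mem_l_infinity[OF bd proj_mem[OF S(1)]] bounded rk by blast
  then show ?thesis
    unfolding approx_number_def
    by (rule INF_lower2) (intro SUP_least sup_norm_sub_proj_le[OF S(1,3) sp(2)])
qed

end

section \<open>From dyadic rates to optimal orders\<close>

text \<open>The strict inequality serves the approximation numbers, whose maps have rank less than
  \<open>n\<close>; it excludes \<open>n = 1\<close>.\<close>

lemma dyadic_below:
  fixes n :: nat
  assumes "n \<ge> 2"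
  obtains k where "2 ^ k < n" "n \<le> 2 * 2 ^ k"
proof -
  have "\<exists>k. 2 ^ k < n \<and> n \<le> 2 * 2 ^ k" using assms
  proof (induction n rule: nat_induct_at_least)
    case base
    then show ?case by (intro exI[of _ 0]) simp
  next
    case (Suc n)
    then obtain k where k: "2 ^ k < n" "n \<le> 2 * 2 ^ k" by blast
    show ?case
    proof (cases "n = 2 * 2 ^ k")
      case True
      then show ?thesis by (intro exI[of _ "Suc k"]) simp
    next
      case False
      then show ?thesis using k by (intro exI[of _ k]) simp
    qed
  qed
  then show thesis using that by blast
qed

text \<open>The exponent \<alpha> itself need not give a null sequence, but every smaller one does,
  and the supremum recovers \<alpha>.\<close>

lemma optimal_order_ge:
  assumes "0 < \<alpha>" and bound: "\<And>n. n \<ge> 2 \<Longrightarrow> s n \<le> ennreal (C * real n powr (- \<alpha>))" and "0 \<le> C"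
  shows "ereal \<alpha> \<le> optimal_order s"
proof (rule dense_le)
  fix y assume y: "y < ereal \<alpha>"
  \<comment> \<open>The maximum with 0 keeps \<open>q\<close> nonnegative when \<open>y\<close> is
    negative or minus infinity.\<close>
  obtain q where q: "max y 0 < ereal q" "ereal q < ereal \<alpha>"
    using ereal_dense3[of "max y 0" "ereal \<alpha>"] assms(1) y by (metis ereal_less(2) ereal_dense2 max_less_iff_conj)
  have q0: "0 \<le> q" "q < \<alpha>" using q by auto
  have "(\<lambda>n. real n powr (q - \<alpha>)) \<longlonglongrightarrow> 0"
    using q0 by (intro tendsto_neg_powr filterlim_real_sequentially) simp
  then have "(\<lambda>n. ennreal (C * real n powr (q - \<alpha>))) \<longlonglongrightarrow> ennreal (C * 0)"
    by (intro tendsto_ennrealI tendsto_mult tendsto_const)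
  then have lim: "(\<lambda>n. ennreal (C * real n powr (q - \<alpha>))) \<longlonglongrightarrow> 0" by simp
  have le: "ennreal (real n powr q) * s n \<le> ennreal (C * real n powr (q - \<alpha>))" if n: "n \<ge> 2" for n
  proof -
    have "ennreal (real n powr q) * s n \<le> ennreal (real n powr q) * ennreal (C * real n powr (- \<alpha>))"
      using bound[OF n] by (intro mult_left_mono) auto
    also have "\<dots> = ennreal (real n powr q * (C * real n powr (- \<alpha>)))"
      by (intro ennreal_mult[symmetric]) (auto simp: assms(3))
    also have "real n powr q * (C * real n powr (- \<alpha>)) = C * real n powr (q - \<alpha>)"
      by (simp add: powr_add[symmetric])
    finally show ?thesis .
  qed
  have "(\<lambda>n. ennreal (real n powr q) * s n) \<longlonglongrightarrow> 0"
    by (rule tendsto_sandwich[OF _ _ tendsto_const lim])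
      (use le in \<open>auto simp: eventually_sequentially\<close>)
  then have "ereal q \<le> optimal_order s"
    unfolding optimal_order_def using q0 by (intro SUP_upper) simp
  then show "y \<le> optimal_order s" using q(1) by (meson less_le_trans less_imp_le max_less_iff_conj)
qed

context rkhs
begin

lemma optimal_orders_ge:
  assumes bd: "\<And>x. x \<in> D \<Longrightarrow> sqn (ker x) \<le> s0\<^sup>2" "0 \<le> s0" and "D \<noteq> {}" and "0 < \<alpha>" "0 \<le> C"
    and E: "\<And>j. orthonormal_set (E j)" "\<And>j. card (E j) \<le> 2 ^ j"
      "\<And>j x. x \<in> D \<Longrightarrow> power2_fun (E j) x \<le> (C * 2 powr (- \<alpha> * real j))\<^sup>2"
  shows "ereal \<alpha> \<le> q_std D H ip" "ereal \<alpha> \<le> q_lin D H ip"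
proof -
  obtain C' where C': "C' > 0" "\<And>k. sampled_power (2 ^ k) (C' * 2 powr (- \<alpha> * real k))"
    using sampled_power_dyadic[OF bd assms(4,5) E] by blast
  have both: "sampling_number D H ip n \<le> ennreal (C' * 2 powr \<alpha> * real n powr (- \<alpha>)) \<and>
    approx_number D H ip n \<le> ennreal (C' * 2 powr \<alpha> * real n powr (- \<alpha>))" if n: "n \<ge> 2" for n
  proof -
    obtain k where k: "2 ^ k < n" "n \<le> 2 * 2 ^ k" using dyadic_below[OF n] .
    let ?s = "C' * 2 powr (- \<alpha> * real k)"
    \<comment> \<open>\<open>n\<close> is at most twice the dyadic number, which costs the factor
      \<open>2 powr \<alpha>\<close>.\<close>
    have "real n \<le> real (2 * 2 ^ k)" using k(2) by (simp only: of_nat_le_iff)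
    then have "real n \<le> 2 * 2 ^ k" by simp
    then have "(2 * 2 ^ k) powr (- \<alpha>) \<le> real n powr (- \<alpha>)"
      using n assms(4) by (intro powr_mono2') auto
    also have "(2 * 2 ^ k :: real) powr (- \<alpha>) = 2 powr (- \<alpha>) * 2 powr (- \<alpha> * real k)"
    proof -
      have "(2 * 2 ^ k :: real) = 2 powr (1 + real k)" by (simp add: powr_add powr_realpow)
      then have "(2 * 2 ^ k :: real) powr (- \<alpha>) = 2 powr ((1 + real k) * - \<alpha>)" by (simp only: powr_powr)
      also have "(1 + real k) * - \<alpha> = - \<alpha> + - \<alpha> * real k" by (simp add: algebra_simps)
      finally show ?thesis by (simp only: powr_add)
    qed
    finally have A: "2 powr \<alpha> * (2 powr (- \<alpha>) * 2 powr (- \<alpha> * real k)) \<le> 2 powr \<alpha> * real n powr (- \<alpha>)"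
      by (intro mult_left_mono) auto
    have B: "2 powr \<alpha> * (2 powr (- \<alpha>) * 2 powr (- \<alpha> * real k)) = 2 powr (- \<alpha> * real k)"
      unfolding mult.assoc[symmetric] powr_add[symmetric] by simp
    from A have "2 powr (- \<alpha> * real k) \<le> 2 powr \<alpha> * real n powr (- \<alpha>)" unfolding B .
    then have le: "ennreal ?s \<le> ennreal (C' * 2 powr \<alpha> * real n powr (- \<alpha>))"
      using C'(1) by (intro ennreal_leI) (simp add: mult.assoc)
    have s0: "0 \<le> ?s" using C'(1) by simp
    have "sampled_power n ?s" using sampled_power_mono[OF C'(2) s0 order.refl] k(1) by simp
    from order.trans[OF sampling_number_le[OF bd assms(3) this s0] le]
      order.trans[OF approx_number_le[OF bd C'(2) s0 k(1)] le]
    show ?thesis ..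
  qed
  have C0: "0 \<le> C' * 2 powr \<alpha>" using C'(1) by simp
  show "ereal \<alpha> \<le> q_std D H ip" "ereal \<alpha> \<le> q_lin D H ip"
    unfolding q_std_def q_lin_def using both
    by (blast intro: optimal_order_ge[OF assms(4) _ C0])+
qed

end

text \<open>An admissible \<open>q\<close> makes
  \<open>n powr q * c * sqrt (n * lam (2 * n))\<close> less than 1 eventually, so the singular
  numbers decay with exponent \<open>q + 1 / 2\<close>; this cannot exceed the supremum
  \<open>p\<close> of all decay exponents.\<close>

lemma optimal_order_le:
  assumes c: "0 < c" and bound: "\<And>n. n \<ge> 1 \<Longrightarrow> ennreal (c * sqrt (real n * lam (2 * n))) \<le> s n"
    and lam: "\<And>k. k \<ge> 1 \<Longrightarrow> 0 < lam k" "\<And>i j. 1 \<le> i \<Longrightarrow> i \<le> j \<Longrightarrow> lam j \<le> lam i"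
    and p: "ereal p = (SUP p' \<in> {p'. sing_decay lam p'}. ereal p')"
  shows "optimal_order s \<le> ereal (p - 1 / 2)"
  unfolding optimal_order_def
proof (rule SUP_least)
  fix q assume "q \<in> {q. 0 \<le> q \<and> (\<lambda>n. ennreal (real n powr q) * s n) \<longlonglongrightarrow> 0}"
  then have q: "0 \<le> q" "(\<lambda>n. ennreal (real n powr q) * s n) \<longlonglongrightarrow> 0" by auto
  have "\<forall>\<^sub>F n in sequentially. ennreal (real n powr q) * s n < 1"
    by (rule order_tendstoD(2)[OF q(2)]) simp
  then obtain N where N: "\<And>n. n \<ge> N \<Longrightarrow> ennreal (real n powr q) * s n < 1"
    unfolding eventually_sequentially by blast
  let ?r = "q + 1 / 2"
  have even: "sing_number lam (2 * n) \<le> (1 / c) * real n powr (- ?r)" if n: "n \<ge> N" "n \<ge> 1" for n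
  proof -
    have l: "0 < lam (2 * n)" using lam(1) n by simp
    have "ennreal (real n powr q * (c * sqrt (real n * lam (2 * n))))
        = ennreal (real n powr q) * ennreal (c * sqrt (real n * lam (2 * n)))"
      using c l by (intro ennreal_mult) auto
    also have "\<dots> \<le> ennreal (real n powr q) * s n" using bound[OF n(2)] by (intro mult_left_mono) auto
    also have "\<dots> < ennreal 1" using N[OF n(1)] by simp
    finally have "real n powr q * (c * sqrt (real n * lam (2 * n))) < 1"
      using c l by (subst (asm) ennreal_less_iff) auto
    also have "real n powr q * (c * sqrt (real n * lam (2 * n))) = c * real n powr ?r * sing_number lam (2 * n)"
      using n by (simp add: sing_number_def real_sqrt_mult powr_add powr_half_sqrt)
    finally have "c * real n powr ?r * sing_number lam (2 * n) \<le> 1" by simp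
    then show ?thesis using c n
      by (simp add: powr_minus field_simps)
  qed
  have "sing_decay lam ?r"
  proof -
    define N' where "N' = 2 * N + 2"
    \<comment> \<open>The first summand serves large \<open>j\<close>; the sum majorizes each of the
      finitely many initial terms.\<close>
    define C where "C = (1 / c) * 4 powr ?r + (\<Sum>j\<le>N'. sing_number lam j * real j powr ?r) + 1"
    have sn: "0 \<le> sing_number lam j * real j powr ?r" for j
      using lam(1)[of j] by (cases "j = 0") (auto simp: sing_number_def)
    have sum0: "0 \<le> (\<Sum>j\<le>N'. sing_number lam j * real j powr ?r)" using sn by (intro sum_nonneg)
    then have C0: "C > 0" unfolding C_def using c by (simp add: add_nonneg_pos)
    have "sing_number lam j \<le> C * real j powr (- ?r)" if j: "j \<ge> 1" for j
    proof -
      have "sing_number lam j * real j powr ?r \<le> C"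
      proof (cases "j \<le> N'")
        case True
        have "sing_number lam j * real j powr ?r \<le> (\<Sum>j\<le>N'. sing_number lam j * real j powr ?r)"
          using True sn by (intro member_le_sum) auto
        moreover have "0 \<le> (1 / c) * 4 powr ?r" using c by simp
        ultimately show ?thesis unfolding C_def by linarith
      next
        case False
        \<comment> \<open>Only even indices are controlled so far. Monotonicity passes from
          \<open>2 * n\<close> to \<open>j\<close>, and \<open>j \<le> 4 * n\<close> turns powers of
          \<open>n\<close> into powers of \<open>j\<close>, whence the 4 in
          \<open>C\<close>.\<close>
        define n where "n = j div 2"
        have n: "n \<ge> N" "n \<ge> 1" "2 * n \<le> j" "real j \<le> 4 * real n" using False unfolding n_def N'_def by linarith+
        have "sing_number lam j \<le> sing_number lam (2 * n)"
          unfolding sing_number_def using n lam(2)[of "2 * n" j] by simp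
        also have "\<dots> \<le> (1 / c) * real n powr (- ?r)" by (rule even[OF n(1,2)])
        also have "\<dots> \<le> (1 / c) * ((real j / 4) powr (- ?r))"
          using n j c q(1) by (intro mult_left_mono powr_mono2') auto
        also have "(real j / 4) powr (- ?r) = 4 powr ?r * real j powr (- ?r)"
          using j by (simp add: powr_divide powr_minus field_simps)
        finally have "sing_number lam j * real j powr ?r \<le> (1 / c) * (4 powr ?r * real j powr (- ?r)) * real j powr ?r"
          by (intro mult_right_mono) auto
        also have "\<dots> = (1 / c) * 4 powr ?r * (real j powr (- ?r + ?r))" by (simp only: powr_add mult_ac)
        also have "\<dots> = (1 / c) * 4 powr ?r" using j by simp
        finally show ?thesis unfolding C_def using sum0 by linarith
      qed
      then show ?thesis using j by (simp add: powr_minus field_simps)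
    qed
    then show ?thesis unfolding sing_decay_def using C0 by blast
  qed
  then have "ereal ?r \<le> ereal p" unfolding p by (intro SUP_upper) simp
  then show "ereal q \<le> ereal (p - 1 / 2)" by simp
qed

section \<open>Completeness of the eigenfunctions\<close>

context rkhs
begin

section \<open>Limits in \<open>H\<close> and representation of functionals\<close>

lemma complete_sqn:
  assumes X: "\<And>n. X n \<in> H"
    and cau: "\<And>\<epsilon>. 0 < \<epsilon> \<Longrightarrow> \<exists>N. \<forall>m\<ge>N. \<forall>n\<ge>N. sqn (X m - X n) < \<epsilon>"
  obtains f where "f \<in> H" "(\<lambda>n::nat. sqn (X n - f)) \<longlonglongrightarrow> 0"
proof -
  have "\<exists>N. \<forall>m\<ge>N. \<forall>n\<ge>N. ip_norm ip (X m - X n) < \<epsilon>" if "0 < \<epsilon>" for \<epsilon>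
  proof -
    obtain N where N: "\<And>m n. m \<ge> N \<Longrightarrow> n \<ge> N \<Longrightarrow> sqn (X m - X n) < \<epsilon>\<^sup>2"
      using cau[of "\<epsilon>\<^sup>2"] \<open>0 < \<epsilon>\<close> by auto
    have "ip_norm ip (X m - X n) < \<epsilon>" if "m \<ge> N" "n \<ge> N" for m n
      using real_sqrt_less_mono[OF N[OF that]] \<open>0 < \<epsilon>\<close> by (simp add: ip_norm_def)
    then show ?thesis by blast
  qed
  then obtain f where f: "f \<in> H" "(\<lambda>n. ip_norm ip (X n - f)) \<longlonglongrightarrow> 0"
    using complete[of X] X by blast
  from f(2) have "(\<lambda>n. (ip_norm ip (X n - f))\<^sup>2) \<longlonglongrightarrow> 0\<^sup>2" by (rule tendsto_power)
  then have "(\<lambda>n. sqn (X n - f)) \<longlonglongrightarrow> 0"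
    by (simp add: ip_norm_sq form.mem_diff X f(1) del: fun_diff_def minus_apply)
  with f(1) show thesis by (rule that)
qed

lemma tendsto_ip:
  assumes "\<And>n. X n \<in> H" "f \<in> H" "g \<in> H" "(\<lambda>n::nat. sqn (X n - f)) \<longlonglongrightarrow> 0"
  shows "(\<lambda>n. ip (X n) g) \<longlonglongrightarrow> ip f g"
proof (rule LIM_zero_cancel)
  have "(\<lambda>n. sqrt (sqn (X n - f)) * sqrt (sqn g)) \<longlonglongrightarrow> sqrt 0 * sqrt (sqn g)"
    by (intro tendsto_intros assms)
  then have lim: "(\<lambda>n. sqrt (sqn (X n - f)) * sqrt (sqn g)) \<longlonglongrightarrow> 0" by simp
  have "norm (ip (X n) g - ip f g) \<le> sqrt (sqn (X n - f)) * sqrt (sqn g)" for n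
    using form.cmod_le[OF form.mem_diff[OF assms(1)[of n] assms(2)] assms(3)]
      form.diff_left[OF assms(1)[of n] assms(2,3)] by (simp only:)
  then show "(\<lambda>n. ip (X n) g - ip f g) \<longlonglongrightarrow> 0"
    by (intro Lim_null_comparison[OF _ lim] always_eventually allI)
qed

lemma tendsto_sqn:
  assumes "\<And>n. X n \<in> H" "f \<in> H" "(\<lambda>n::nat. sqn (X n - f)) \<longlonglongrightarrow> 0"
  shows "(\<lambda>n. sqn (X n)) \<longlonglongrightarrow> sqn f"
proof -
  have "sqn (X n) = sqn (X n - f) + 2 * Re (ip (X n) f) - sqn f" for n
    using form.Re_diff_self[OF assms(1)[of n] assms(2)] by linarith
  moreover have "(\<lambda>n. sqn (X n - f) + 2 * Re (ip (X n) f) - sqn f) \<longlonglongrightarrow> 0 + 2 * Re (ip f f) - sqn f"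
    using tendsto_ip[OF assms(1,2,2,3)] by (intro tendsto_intros assms(3))
  ultimately show ?thesis by simp
qed

lemma ip_eqI:
  assumes "f \<in> H" "g \<in> H" "\<And>h. h \<in> H \<Longrightarrow> ip f h = ip g h"
  shows "f = g"
proof -
  have "ip (f - g) (f - g) = 0"
    using assms(3)[OF form.mem_diff[OF assms(1,2)]] form.diff_left[OF assms(1,2) form.mem_diff[OF assms(1,2)]]
    by simp
  then have "f - g = 0" by (intro ip_definite form.mem_diff assms)
  then show ?thesis by simp
qed

text \<open>The representer is the minimizer of \<open>\<parallel>h\<parallel>\<^sup>2 - 2 Re \<phi> h\<close>.\<close>

lemma Riesz_representation:
  assumes add: "\<And>g h. g \<in> H \<Longrightarrow> h \<in> H \<Longrightarrow> \<phi> (g + h) = \<phi> g + \<phi> h"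
    and scale: "\<And>c g. g \<in> H \<Longrightarrow> \<phi> (cscale c g) = cnj c * \<phi> g"
    and bound: "\<And>g. g \<in> H \<Longrightarrow> cmod (\<phi> g) \<le> C * sqrt (sqn g)"
  obtains h where "h \<in> H" "\<And>g. g \<in> H \<Longrightarrow> ip h g = \<phi> g"
proof -
  define F where "F h = sqn h - 2 * Re (\<phi> h)" for h
  have lower: "- C\<^sup>2 \<le> F h" if "h \<in> H" for h
  proof -
    have "Re (\<phi> h) \<le> C * sqrt (sqn h)" using bound[OF that] complex_Re_le_cmod[of "\<phi> h"] by linarith
    moreover have "0 \<le> (sqrt (sqn h) - C)\<^sup>2" by simp
    then have "0 \<le> sqn h - 2 * (C * sqrt (sqn h)) + C\<^sup>2"
      using ip_nonneg[OF that] by (simp add: power2_diff mult_ac)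
    ultimately show ?thesis unfolding F_def by linarith
  qed
  define m where "m = Inf (F ` H)"
  have bdd: "bdd_below (F ` H)" using lower by (meson bdd_belowI2)
  have m_le: "m \<le> F h" if "h \<in> H" for h unfolding m_def by (rule cINF_lower[OF bdd that])
  have "\<exists>h\<in>H. F h < m + 1 / Suc n" for n
  proof (rule ccontr)
    assume "\<not> ?thesis"
    then have "m + 1 / Suc n \<le> m"
      unfolding m_def using form.mem_zero by (intro cINF_greatest) (auto simp: m_def not_less)
    then show False by simp
  qed
  then obtain X where X: "\<And>n. X n \<in> H" "\<And>n. F (X n) < m + 1 / Suc n" by metis
  have diff: "sqn (X a - X b) \<le> 2 / Suc a + 2 / Suc b" for a b
  proof -
    \<comment> \<open>The midpoint is a competitor as well; by the parallelogram law two nearly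
      minimal vectors must then be close.\<close>
    let ?c = "cscale (of_real (1/2)) (X a + X b)"
    have c: "?c \<in> H" by (intro form.mem X)
    have "F ?c = sqn (X a + X b) / 4 - Re (\<phi> (X a)) - Re (\<phi> (X b))"
      unfolding F_def form.Re_scale_self[OF form.mem_add[OF X(1)[of a] X(1)[of b]]]
        scale[OF form.mem_add[OF X(1)[of a] X(1)[of b]]] add[OF X(1)[of a] X(1)[of b]]
      by (simp add: power2_eq_square field_simps)
    with m_le[OF c] X(2)[of a] X(2)[of b] form.parallelogram[OF X(1)[of a] X(1)[of b]]
    show ?thesis unfolding F_def by linarith
  qed
  have "\<exists>N. \<forall>a\<ge>N. \<forall>b\<ge>N. sqn (X a - X b) < \<epsilon>" if "0 < \<epsilon>" for \<epsilon>
  proof -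
    have "0 < \<epsilon> / 4" using that by simp
    then obtain N where N: "inverse (real (Suc N)) < \<epsilon> / 4" using reals_Archimedean by blast
    have "sqn (X a - X b) < \<epsilon>" if "a \<ge> N" "b \<ge> N" for a b
    proof -
      have "1 / real (Suc a) \<le> 1 / real (Suc N)" "1 / real (Suc b) \<le> 1 / real (Suc N)"
        using that by (auto simp: field_simps)
      moreover have "sqn (X a - X b) \<le> 2 * (1 / Suc a) + 2 * (1 / Suc b)" using diff[of a b] by simp
      ultimately show ?thesis using N unfolding inverse_eq_divide by linarith
    qed
    then show ?thesis by blast
  qed
  then obtain h where h: "h \<in> H" "(\<lambda>n. sqn (X n - h)) \<longlonglongrightarrow> 0"
    using complete_sqn[of X] X(1) by blast
  have "\<phi> (X n) - \<phi> h = \<phi> (X n - h)" for n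
    using add[OF form.mem_diff[OF X(1)[of n] h(1)] h(1)] by simp
  then have dl: "norm (\<phi> (X n) - \<phi> h) \<le> C * sqrt (sqn (X n - h))" for n
    using bound[OF form.mem_diff[OF X(1)[of n] h(1)]] by simp
  have "(\<lambda>n. C * sqrt (sqn (X n - h))) \<longlonglongrightarrow> C * sqrt 0" by (intro tendsto_intros h)
  then have "(\<lambda>n. C * sqrt (sqn (X n - h))) \<longlonglongrightarrow> 0" by simp
  then have "(\<lambda>n. \<phi> (X n) - \<phi> h) \<longlonglongrightarrow> 0"
    by (rule Lim_null_comparison[rotated]) (intro always_eventually allI dl)
  then have "(\<lambda>n. \<phi> (X n)) \<longlonglongrightarrow> \<phi> h" by (rule LIM_zero_cancel)
  then have "(\<lambda>n. F (X n)) \<longlonglongrightarrow> F h"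
    unfolding F_def by (intro tendsto_intros tendsto_sqn[OF X(1) h])
  moreover have "(\<lambda>n. m + 1 / Suc n) \<longlonglongrightarrow> m + 0"
    by (intro tendsto_intros LIMSEQ_Suc[OF lim_1_over_n])
  ultimately have Fh: "F h \<le> m"
    using X(2) by (intro LIMSEQ_le[of _ "F h" _ m]) (auto intro: less_imp_le)
  have re: "Re (ip h g) = Re (\<phi> g)" if g: "g \<in> H" for g
  proof -
    have "Re (ip h g) - Re (\<phi> g) = 0"
    proof (rule quadratic_nonneg_imp_zero[of _ "sqn g"])
      fix t :: real
      have "F h \<le> F (h + cscale (of_real t) g)" using Fh m_le[of "h + cscale (of_real t) g"] h g
        by (meson form.mem_add form.mem_scale order.trans)
      then show "0 \<le> 2 * t * (Re (ip h g) - Re (\<phi> g)) + t\<^sup>2 * sqn g"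
        unfolding F_def form.Re_combination_self[OF h(1) g] add[OF h(1) form.mem_scale[OF g]] scale[OF g]
        by (simp add: algebra_simps)
    qed
    then show ?thesis by simp
  qed
  \<comment> \<open>The first variation gives real parts only; testing with
    \<open>cscale \<i> g\<close> supplies the imaginary part.\<close>
  have "ip h g = \<phi> g" if g: "g \<in> H" for g
    using re[OF g] re[OF form.mem_scale[OF g, of \<i>]] form.scale_right[OF g h(1), of \<i>] scale[OF g, of \<i>]
    by (simp add: complex_eq_iff)
  with h(1) show thesis by (rule that)
qed

end

section \<open>Continuity of functions in \<open>H\<close> and the \<open>L2\<close> form on a
  compact domain\<close>

locale continuous_rkhs = rkhs D K H ip
  for D :: "'a::euclidean_space set" and K H ip +
  fixes M :: "'a measure"
  assumes compact_D: "compact D"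
    and continuous_K: "continuous_on (D \<times> D) (\<lambda>(x, y). K x y)"
    and borel_M: "finite_borel_measure_on D M"
    and support_M: "full_support D M"
begin

lemma ker_apply: "x \<in> D \<Longrightarrow> y \<in> D \<Longrightarrow> ip (ker x) (ker y) = K y x"
  using reproducing[of "ker x" y] kernel_in[of x] by (simp add: kernel_section_def)

lemma continuous_diagonal: "continuous_on D (\<lambda>x. K x x)"
  using continuous_on_compose2[OF continuous_K, of D "\<lambda>x. (x, x)"]
  by (simp add: continuous_on_Pair image_subset_iff)

lemma continuous_section: "x \<in> D \<Longrightarrow> continuous_on D (\<lambda>y. K y x)"
  using continuous_on_compose2[OF continuous_K, of D "\<lambda>y. (y, x)"]
  by (simp add: continuous_on_Pair image_subset_iff)

lemma sqn_ker_bound: "\<exists>s0\<ge>0. \<forall>x\<in>D. sqn (ker x) \<le> s0\<^sup>2"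
proof -
  have "bounded ((\<lambda>x. K x x) ` D)"
    by (intro compact_imp_bounded compact_continuous_image continuous_diagonal compact_D)
  then obtain b where b: "\<And>x. x \<in> D \<Longrightarrow> cmod (K x x) \<le> b" unfolding bounded_iff by auto
  have "sqn (ker x) \<le> (sqrt \<bar>b\<bar>)\<^sup>2" if "x \<in> D" for x
    using b[OF that] complex_Re_le_cmod[of "K x x"] by (simp add: ker_apply that)
  then show ?thesis by (intro exI[of _ "sqrt \<bar>b\<bar>"]) auto
qed

text \<open>The squared distance of two kernel sections is a combination of kernel values, so
  continuity of \<open>K\<close> makes the map from points to sections continuous.\<close>

lemma ker_continuous:
  assumes "x \<in> D" "0 < \<epsilon>"
  shows "\<exists>d>0. \<forall>y\<in>D. dist x y < d \<longrightarrow> sqn (ker x - ker y) < \<epsilon>"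
proof -
  have eq: "sqn (ker x - ker y) = Re (K x x) - 2 * Re (K y x) + Re (K y y)" if "y \<in> D" for y
    using form.Re_diff_self[OF kernel_in[OF assms(1)] kernel_in[OF that]] by (simp add: ker_apply assms that)
  have "continuous_on D (\<lambda>y. Re (K x x) - 2 * Re (K y x) + Re (K y y))"
    by (intro continuous_intros continuous_section continuous_diagonal assms)
  then obtain d where d: "d > 0" "\<And>y. y \<in> D \<Longrightarrow> dist y x < d \<Longrightarrow>
      dist (Re (K x x) - 2 * Re (K y x) + Re (K y y)) (Re (K x x) - 2 * Re (K x x) + Re (K x x)) < \<epsilon>"
    unfolding continuous_on_iff using assms by blast
  then have "sqn (ker x - ker y) < \<epsilon>" if "y \<in> D" "dist x y < d" for y
    using d(2)[OF that(1)] that(2) by (simp add: eq[OF that(1)] dist_commute dist_real_def del: fun_diff_def minus_apply)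
  with d(1) show ?thesis by blast
qed

lemma value_diff_le:
  assumes "f \<in> H" "x \<in> D" "y \<in> D"
  shows "cmod (f x - f y) \<le> sqrt (sqn f) * sqrt (sqn (ker x - ker y))"
  using form.cmod_le[OF assms(1) form.mem_diff[OF kernel_in[OF assms(2)] kernel_in[OF assms(3)]]]
    form.diff_right[OF kernel_in[OF assms(2)] kernel_in[OF assms(3)] assms(1)]
    reproducing[OF assms(1,2)] reproducing[OF assms(1,3)]
  by simp

text \<open>By Cauchy-Schwarz the modulus of continuity of the kernel sections serves a whole ball
  of \<open>H\<close> at once. This is the source of compactness for Arzela-Ascoli.\<close>

lemma equicontinuous:
  assumes "x \<in> D" "0 < \<epsilon>"
  shows "\<exists>d>0. \<forall>f\<in>H. \<forall>y\<in>D. sqn f \<le> B \<longrightarrow> norm (x - y) < d \<longrightarrow> norm (f x - f y) < \<epsilon>"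
proof -
  define b where "b = \<bar>B\<bar> + 1"
  have b: "b > 0" "B \<le> b" by (auto simp: b_def)
  obtain d where d: "d > 0" "\<And>y. y \<in> D \<Longrightarrow> dist x y < d \<Longrightarrow> sqn (ker x - ker y) < (\<epsilon> / sqrt b)\<^sup>2"
    using ker_continuous[OF assms(1), of "(\<epsilon> / sqrt b)\<^sup>2"] assms(2) b by auto
  have "norm (f x - f y) < \<epsilon>" if "f \<in> H" "y \<in> D" "sqn f \<le> B" "norm (x - y) < d" for f y
  proof -
    have "sqrt (sqn (ker x - ker y)) < \<epsilon> / sqrt b"
      using real_sqrt_less_mono[OF d(2)[OF that(2)]] that(4) assms(2) b by (simp add: dist_norm)
    moreover have "sqrt (sqn f) \<le> sqrt b" using that(3) b by simp
    moreover have "0 \<le> sqrt (sqn (ker x - ker y))" "0 < sqrt b"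
      using b assms(1) that(2) by (auto intro!: ip_nonneg form.mem_diff kernel_in)
    ultimately have "sqrt (sqn f) * sqrt (sqn (ker x - ker y)) < sqrt b * (\<epsilon> / sqrt b)"
      by (meson le_less_trans mult_right_mono mult_strict_left_mono)
    with value_diff_le[OF that(1) assms(1) that(2)] b show ?thesis by simp
  qed
  with d(1) show ?thesis by blast
qed

lemma continuous_on_mem: "f \<in> H \<Longrightarrow> continuous_on D f"
  unfolding continuous_on_iff using equicontinuous[of _ _ "sqn f"]
  by (metis dist_commute dist_norm order.refl)

lemma space_M: "space M = D" and sets_M: "sets M = sets (restrict_space borel D)"
  using borel_M sets_eq_imp_space_eq[of M "restrict_space borel D"]
  by (auto simp: finite_borel_measure_on_def space_restrict_space)

lemma finite_M: "finite_measure M"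
  using borel_M by (simp add: finite_borel_measure_on_def)

lemma measurable_mem: "f \<in> H \<Longrightarrow> f \<in> borel_measurable M"
  using borel_measurable_continuous_on_restrict[OF continuous_on_mem, of f]
  by (simp add: measurable_cong_sets[OF sets_M refl])

lemma integrable_product:
  assumes "f \<in> H" "g \<in> H"
  shows "integrable M (\<lambda>x. f x * cnj (g x))"
proof -
  obtain s0 where s0: "0 \<le> s0" "\<And>x. x \<in> D \<Longrightarrow> sqn (ker x) \<le> s0\<^sup>2"
    using sqn_ker_bound by metis
  have "norm (f x * cnj (g x)) \<le> (s0 * sqrt (sqn f)) * (s0 * sqrt (sqn g))" if "x \<in> D" for x
    unfolding norm_mult complex_mod_cnj
    using s0 assms that by (intro mult_mono value_le_bound) (auto simp: ip_nonneg)
  then have "AE x in M. norm (f x * cnj (g x)) \<le> (s0 * sqrt (sqn f)) * (s0 * sqrt (sqn g))"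
    by (intro AE_I2) (simp add: space_M)
  moreover have "(\<lambda>x. f x * cnj (g x)) \<in> borel_measurable M"
  proof (rule borel_measurable_times)
    have "cnj \<in> borel_measurable borel"
      by (intro borel_measurable_continuous_onI continuous_intros)
    then show "(\<lambda>x. cnj (g x)) \<in> borel_measurable M"
      by (rule measurable_compose[OF measurable_mem[OF assms(2)]])
  qed (rule measurable_mem[OF assms(1)])
  ultimately show ?thesis by (rule finite_measure.integrable_const_bound[OF finite_M])
qed

lemma L2_bound:
  assumes "f \<in> H" "g \<in> H" "\<And>x. x \<in> D \<Longrightarrow> cmod (f x) \<le> A" "\<And>x. x \<in> D \<Longrightarrow> cmod (g x) \<le> B" "0 \<le> A"
  shows "cmod (L2_ip M f g) \<le> A * B * measure M D"
proof -
  interpret finite_measure M by (rule finite_M)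
  have "cmod (L2_ip M f g) \<le> (\<integral>x. norm (f x * cnj (g x)) \<partial>M)"
    unfolding L2_ip_def by (rule integral_norm_bound)
  also have "\<dots> \<le> (\<integral>x. A * B \<partial>M)"
  proof (rule integral_mono)
    show "integrable M (\<lambda>x. norm (f x * cnj (g x)))"
      by (intro integrable_norm integrable_product assms)
    fix x assume "x \<in> space M"
    then show "norm (f x * cnj (g x)) \<le> A * B"
      unfolding norm_mult complex_mod_cnj space_M using assms by (intro mult_mono) auto
  qed simp
  also have "\<dots> = A * B * measure M D" by (simp add: space_M mult.commute)
  finally show ?thesis .
qed

lemma L2_self:
  assumes "f \<in> H"
  shows "L2_ip M f f = of_real (\<integral>x. (cmod (f x))\<^sup>2 \<partial>M)" "integrable M (\<lambda>x. (cmod (f x))\<^sup>2)"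
proof -
  have eq: "f x * cnj (f x) = of_real ((cmod (f x))\<^sup>2)" for x by (simp only: complex_norm_square)
  have "integrable M (\<lambda>x. complex_of_real ((cmod (f x))\<^sup>2))"
    using integrable_product[OF assms assms] by (simp only: eq)
  then show "integrable M (\<lambda>x. (cmod (f x))\<^sup>2)" by (simp only: complex_of_real_integrable_eq)
  then show "L2_ip M f f = of_real (\<integral>x. (cmod (f x))\<^sup>2 \<partial>M)"
    unfolding L2_ip_def eq by (simp only: Bochner_Integration.integral_of_real)
qed

sublocale L2: hermitian_form H "L2_ip M"
proof
  fix f g h c assume f: "f \<in> H" and g: "g \<in> H"
  show "L2_ip M (cscale c f) g = c * L2_ip M f g"
    using integrable_product[OF f g] by (simp add: L2_ip_def cscale_apply mult.assoc)
  show "L2_ip M g f = cnj (L2_ip M f g)"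
    unfolding L2_ip_def Bochner_Integration.integral_cnj[symmetric]
    by (simp add: mult.commute del: Bochner_Integration.integral_cnj)
  show "L2_ip M (f + g) h = L2_ip M f h + L2_ip M g h" if "h \<in> H" for h
    using integrable_product[OF f that] integrable_product[OF g that]
    by (simp add: L2_ip_def distrib_right)
next
  show "cfun.subspace H" by (rule subspace)
  show "0 \<le> Re (L2_ip M f f)" if "f \<in> H" for f
    using L2_self(1)[OF that] by simp
qed

text \<open>\<open>f\<close> is continuous, so the set where it does not vanish is open in
  \<open>D\<close>. Being a null set, it is empty by full support.\<close>

lemma L2_definite:
  assumes f: "f \<in> H" and zero: "Re (L2_ip M f f) = 0"
  shows "f = 0"
proof -
  have "(\<integral>x. (cmod (f x))\<^sup>2 \<partial>M) = 0" using zero L2_self(1)[OF f] by simp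
  then have ae: "AE x in M. (cmod (f x))\<^sup>2 = 0"
    using integral_nonneg_eq_0_iff_AE[OF L2_self(2)[OF f]] by simp
  let ?U = "{x \<in> D. f x \<in> - {0}}"
  have op: "openin (top_of_set D) ?U"
    by (rule continuous_openin_preimage_gen[OF continuous_on_mem[OF f], of "- {0}", unfolded vimage_def Int_def mem_Collect_eq])
      (simp add: open_Compl)
  obtain T where T: "open T" "?U = D \<inter> T" using op unfolding openin_open by blast
  have "?U \<in> sets M"
    unfolding T(2) sets_M sets_restrict_space using borel_open[OF T(1)] by (rule imageI)
  moreover have "{x \<in> space M. \<not> (cmod (f x))\<^sup>2 = 0} = ?U" by (auto simp: space_M)
  ultimately have "emeasure M ?U = 0" using ae by (subst (asm) AE_iff_measurable)
  then have "?U = {}" using support_M op unfolding full_support_def by (metis less_irrefl)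
  then show ?thesis using vanish[OF f] by (auto simp: fun_eq_iff)
qed

lemma L2_ip_le: "\<exists>c\<ge>0. \<forall>f\<in>H. \<forall>g\<in>H. cmod (L2_ip M f g) \<le> c * sqrt (sqn f) * sqrt (sqn g)"
proof -
  obtain s0 where s0: "0 \<le> s0" "\<And>x. x \<in> D \<Longrightarrow> sqn (ker x) \<le> s0\<^sup>2"
    using sqn_ker_bound by metis
  have "cmod (L2_ip M f g) \<le> (s0 * s0 * measure M D) * sqrt (sqn f) * sqrt (sqn g)"
    if "f \<in> H" "g \<in> H" for f g
    using L2_bound[OF that value_le_bound[OF s0(2,1) that(1)] value_le_bound[OF s0(2,1) that(2)]]
      s0(1) ip_nonneg[OF that(1)] by (simp add: mult_ac)
  then show ?thesis using s0 by (intro exI[of _ "s0 * s0 * measure M D"]) simp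
qed

lemma J_adjoint_eqI:
  assumes "h \<in> H" "\<And>g. g \<in> H \<Longrightarrow> ip h g = L2_ip M f g"
  shows "J_adjoint H ip M f = h"
  unfolding J_adjoint_def using assms by (intro the_equality) (auto intro!: ip_eqI)

text \<open>The definite description in \<open>J_adjoint\<close> acquires content here: existence
  comes from the Riesz representation, uniqueness from \<open>ip_eqI\<close>.\<close>

lemma J_adjoint_exists:
  assumes f: "f \<in> H"
  shows "J_adjoint H ip M f \<in> H" "g \<in> H \<Longrightarrow> ip (J_adjoint H ip M f) g = L2_ip M f g"
proof -
  obtain c where "0 \<le> c"
    and c: "\<And>f g. f \<in> H \<Longrightarrow> g \<in> H \<Longrightarrow> cmod (L2_ip M f g) \<le> c * sqrt (sqn f) * sqrt (sqn g)"
    using L2_ip_le by metis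
  obtain h where h: "h \<in> H" "\<And>g. g \<in> H \<Longrightarrow> ip h g = L2_ip M f g"
    using Riesz_representation[of "L2_ip M f" "c * sqrt (sqn f)"] L2.add_right[OF _ _ f]
      L2.scale_right[OF _ f] c[OF f] by blast
  have "J_adjoint H ip M f = h" by (rule J_adjoint_eqI[OF h])
  with h show "J_adjoint H ip M f \<in> H" "g \<in> H \<Longrightarrow> ip (J_adjoint H ip M f) g = L2_ip M f g" by auto
qed

end

section \<open>The extremal problem for the \<open>L2\<close> norm and completeness\<close>

locale spectral_rkhs = continuous_rkhs D K H ip M
  for D :: "'a::euclidean_space set" and K H ip M +
  fixes lam :: "nat \<Rightarrow> real" and e :: "nat \<Rightarrow> 'a \<Rightarrow> complex"
  assumes spectral: "spectral_data H ip M lam e"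
begin

lemma lam_pos: "1 \<le> k \<Longrightarrow> 0 < lam k"
  and lam_antimono: "1 \<le> i \<Longrightarrow> i \<le> j \<Longrightarrow> lam j \<le> lam i"
  and e_mem: "1 \<le> k \<Longrightarrow> e k \<in> H"
  and J_e: "1 \<le> k \<Longrightarrow> J_adjoint H ip M (e k) = cscale (of_real (lam k)) (e k)"
  and ip_e: "1 \<le> i \<Longrightarrow> 1 \<le> j \<Longrightarrow> ip (e i) (e j) = (if i = j then 1 else 0)"
  and eigenspace: "0 < \<mu> \<Longrightarrow> {f \<in> H. J_adjoint H ip M f = cscale (of_real \<mu>) f}
      = cfun.span (e ` {k. 1 \<le> k \<and> lam k = \<mu>})"
  using spectral unfolding spectral_data_def by blast+

lemma L2_e:
  assumes "1 \<le> k" "g \<in> H"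
  shows "L2_ip M (e k) g = of_real (lam k) * ip (e k) g"
  using J_adjoint_exists(2)[OF e_mem[OF assms(1)] assms(2)] J_e[OF assms(1)]
    form.scale_left[OF e_mem[OF assms(1)] assms(2)] by simp

lemma L2_e_right:
  assumes "1 \<le> k" "g \<in> H"
  shows "L2_ip M g (e k) = of_real (lam k) * ip g (e k)"
  using L2.conj_sym[OF e_mem[OF assms(1)] assms(2)] form.conj_sym[OF e_mem[OF assms(1)] assms(2)]
    L2_e[OF assms] by simp

text \<open>A maximizing sequence for the \<open>L\<^sub>2\<close> norm on the unit ball of \<open>H0\<close> has a uniformly convergent
  subsequence by the Arzela-Ascoli theorem. The parallelogram identity turns the convergence in \<open>L\<^sub>2\<close>
  into convergence in \<open>H\<close>, because the \<open>L\<^sub>2\<close> norms are nearly maximal.\<close>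

lemma maximizer_exists:
  assumes sub: "cfun.subspace H0" "H0 \<subseteq> H"
    and closed: "\<And>X f. (\<And>n. X n \<in> H0) \<Longrightarrow> f \<in> H \<Longrightarrow> (\<lambda>n::nat. sqn (X n - f)) \<longlonglongrightarrow> 0 \<Longrightarrow> f \<in> H0"
    and f0: "f0 \<in> H0" "f0 \<noteq> 0"
  obtains h \<mu> where "0 < \<mu>" "h \<in> H0" "h \<noteq> 0" "Re (L2_ip M h h) = \<mu> * sqn h"
    "\<And>f. f \<in> H0 \<Longrightarrow> Re (L2_ip M f f) \<le> \<mu> * sqn f"
proof -
  let ?Q = "\<lambda>f. Re (L2_ip M f f)"
  obtain c where c: "0 \<le> c"
    "\<And>f g. f \<in> H \<Longrightarrow> g \<in> H \<Longrightarrow> cmod (L2_ip M f g) \<le> c * sqrt (sqn f) * sqrt (sqn g)"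
    using L2_ip_le by metis
  have Qc: "?Q f \<le> c * sqn f" if "f \<in> H" for f
    using c(2)[OF that that] complex_Re_le_cmod[of "L2_ip M f f"] ip_nonneg[OF that]
    by (simp add: mult.assoc)
  define U where "U = ?Q ` {f \<in> H0. sqn f \<le> 1}"
  define \<mu> where "\<mu> = Sup U"
  have bdd: "bdd_above U"
  proof (rule bdd_aboveI)
    fix y assume "y \<in> U"
    then obtain f where f: "f \<in> H" "sqn f \<le> 1" "y = ?Q f" using sub(2) by (auto simp: U_def)
    have "c * sqn f \<le> c * 1" using f c(1) by (intro mult_left_mono) auto
    with Qc[OF f(1)] f(3) show "y \<le> c" by simp
  qed
  have le1: "?Q f \<le> \<mu>" if "f \<in> H0" "sqn f \<le> 1" for f
    unfolding \<mu>_def using that by (intro cSup_upper bdd) (auto simp: U_def)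
  have le: "?Q f \<le> \<mu> * sqn f" if f: "f \<in> H0" for f
  proof (cases "f = 0")
    case True
    then show ?thesis by (simp add: form.zero_left L2.zero_left form.mem_zero)
  next
    case False
    have fH: "f \<in> H" using f sub(2) by blast
    let ?g = "cscale (of_real (1 / sqrt (sqn f))) f"
    have pos: "0 < sqn f" using sqn_zero_iff[OF fH] False ip_nonneg[OF fH] by linarith
    have "?g \<in> H0" using f sub(1) by (intro cfun.subspace_scale)
    with sqn_normalized(1)[OF fH False] have "?Q ?g \<le> \<mu>" by (intro le1) auto
    moreover have "?Q ?g = ?Q f / sqn f"
      unfolding L2.Re_scale_self[OF fH] using pos by (simp add: norm_divide power_divide)
    ultimately have "?Q f / sqn f \<le> \<mu>" by (simp only:)
    then show ?thesis using pos by (simp only: pos_divide_le_eq)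
  qed
  have f0H: "f0 \<in> H" using f0 sub(2) by blast
  \<comment> \<open>\<mu> is positive because the \<open>L2\<close> form is definite on
    \<open>H\<close> and \<open>f0\<close> is nonzero.\<close>
  have "0 < ?Q f0" using L2.nonneg[OF f0H] L2_definite[OF f0H] f0(2) by linarith
  also have "\<dots> \<le> \<mu> * sqn f0" by (rule le[OF f0(1)])
  finally have "0 < \<mu> * sqn f0" .
  then have mu: "0 < \<mu>" using ip_nonneg[OF f0H] by (simp add: zero_less_mult_iff)
  have Une: "U \<noteq> {}" unfolding U_def using cfun.subspace_0[OF sub(1)]
    by (auto simp: form.zero_left form.mem_zero intro!: exI[of _ 0])
  have "\<exists>f\<in>H0. sqn f \<le> 1 \<and> \<mu> - 1 / Suc n < ?Q f" for n
  proof -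
    have "\<mu> - 1 / Suc n < Sup U" unfolding \<mu>_def by simp
    from less_cSupD[OF Une this] show ?thesis unfolding U_def by blast
  qed
  then obtain f where f: "\<And>n. f n \<in> H0" "\<And>n. sqn (f n) \<le> 1" "\<And>n. \<mu> - 1 / Suc n < ?Q (f n)" by metis
  have fH: "f n \<in> H" for n using f(1) sub(2) by blast
  obtain s0 where s0: "0 \<le> s0" "\<And>x. x \<in> D \<Longrightarrow> sqn (ker x) \<le> s0\<^sup>2" using sqn_ker_bound by metis
  have "\<exists>g k. strict_mono (k :: nat \<Rightarrow> nat) \<and>
    (\<forall>\<epsilon>>0. \<exists>N. \<forall>n x. n \<ge> N \<and> x \<in> D \<longrightarrow> norm (f (k n) x - g x) < \<epsilon>)"
  proof (rule Arzela_Ascoli[OF compact_D, of f s0])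
    fix n x assume x: "x \<in> D"
    have "s0 * sqrt (sqn (f n)) \<le> s0 * 1" using f(2)[of n] s0(1) by (intro mult_left_mono) auto
    with value_le_bound[OF s0(2,1) fH x, of n] show "norm (f n x) \<le> s0" by simp
  next
    fix x \<epsilon> assume "x \<in> D" "(0::real) < \<epsilon>"
    from equicontinuous[OF this, of 1]
    show "\<exists>d>0. \<forall>n y. y \<in> D \<and> norm (x - y) < d \<longrightarrow> norm (f n x - f n y) < \<epsilon>"
      using fH f(2) by blast
  qed blast
  then obtain g and k :: "nat \<Rightarrow> nat" where k: "strict_mono k"
    "\<And>\<epsilon>. 0 < \<epsilon> \<Longrightarrow> \<exists>N. \<forall>n x. n \<ge> N \<and> x \<in> D \<longrightarrow> norm (f (k n) x - g x) < \<epsilon>"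
    by blast
  define X where "X n = f (k n)" for n
  have X0: "X n \<in> H0" and XH: "X n \<in> H" and X1: "sqn (X n) \<le> 1" for n
    using f fH by (auto simp: X_def)
  have XQ: "\<mu> - 1 / Suc n < ?Q (X n)" for n
  proof -
    have "1 / real (Suc (k n)) \<le> 1 / real (Suc n)"
      using seq_suble[OF k(1), of n] by (simp add: field_simps)
    with f(3)[of "k n"] show ?thesis unfolding X_def by linarith
  qed
  have Qd: "\<exists>N. \<forall>a\<ge>N. \<forall>b\<ge>N. ?Q (X a - X b) < \<epsilon>" if "0 < \<epsilon>" for \<epsilon>
  proof -
    define m where "m = measure M D"
    have m0: "m \<ge> 0" by (simp add: m_def)
    define t where "t = sqrt (\<epsilon> / (m + 1))"
    have t: "t > 0" "t\<^sup>2 * m < \<epsilon>"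
      using that m0 by (auto simp: t_def field_simps)
    obtain N where N: "\<And>n x. n \<ge> N \<Longrightarrow> x \<in> D \<Longrightarrow> norm (f (k n) x - g x) < t / 2"
      using k(2)[of "t / 2"] t by auto
    have "?Q (X a - X b) < \<epsilon>" if ab: "a \<ge> N" "b \<ge> N" for a b
    proof -
      have d: "cmod ((X a - X b) x) \<le> t" if "x \<in> D" for x
        using N[OF ab(1) that] N[OF ab(2) that] norm_triangle_ineq4[of "f (k a) x - g x" "f (k b) x - g x"]
        by (simp add: X_def)
      have "cmod (L2_ip M (X a - X b) (X a - X b)) \<le> t * t * measure M D"
        using t by (intro L2_bound form.mem_diff XH d) auto
      then show ?thesis using complex_Re_le_cmod[of "L2_ip M (X a - X b) (X a - X b)"] t(2)
        by (simp only: power2_eq_square m_def)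
    qed
    then show ?thesis by blast
  qed
  have "\<exists>N. \<forall>a\<ge>N. \<forall>b\<ge>N. sqn (X a - X b) < \<epsilon>" if "0 < \<epsilon>" for \<epsilon>
  proof -
    have "0 < \<mu> * \<epsilon> / 2" using mu that by simp
    then obtain N1 where N1: "\<And>a b. a \<ge> N1 \<Longrightarrow> b \<ge> N1 \<Longrightarrow> ?Q (X a - X b) < \<mu> * \<epsilon> / 2"
      using Qd by blast
    have "0 < \<mu> * \<epsilon> / 8" using mu that by simp
    then obtain N2 where N2: "inverse (real (Suc N2)) < \<mu> * \<epsilon> / 8" using reals_Archimedean by blast
    have "sqn (X a - X b) < \<epsilon>" if ab: "a \<ge> max N1 N2" "b \<ge> max N1 N2" for a b
    proof -
      have "1 / real (Suc a) \<le> 1 / real (Suc N2)" "1 / real (Suc b) \<le> 1 / real (Suc N2)"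
        using ab by (auto simp: field_simps)
      with N2 XQ[of a] XQ[of b] have Qab: "\<mu> - \<mu> * \<epsilon> / 8 < ?Q (X a)" "\<mu> - \<mu> * \<epsilon> / 8 < ?Q (X b)"
        unfolding inverse_eq_divide by linarith+
      have "?Q (X a + X b) \<le> \<mu> * sqn (X a + X b)" by (intro le cfun.subspace_add sub X0)
      moreover have "?Q (X a + X b) = 2 * ?Q (X a) + 2 * ?Q (X b) - ?Q (X a - X b)"
        using L2.parallelogram[OF XH[of a] XH[of b]] by linarith
      ultimately have "4 * \<mu> - \<mu> * \<epsilon> < \<mu> * sqn (X a + X b)"
        using N1[of a b] ab Qab by simp
      then have "\<mu> * (4 - \<epsilon>) < \<mu> * sqn (X a + X b)" by (simp add: algebra_simps)
      then have "4 - \<epsilon> < sqn (X a + X b)" using mu by simp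
      moreover have "sqn (X a + X b) + sqn (X a - X b) \<le> 4"
        using form.parallelogram[OF XH[of a] XH[of b]] X1[of a] X1[of b] by linarith
      ultimately show ?thesis by linarith
    qed
    then show ?thesis by blast
  qed
  then obtain h where h: "h \<in> H" "(\<lambda>n. sqn (X n - h)) \<longlonglongrightarrow> 0"
    using complete_sqn[of X] XH by blast
  have h0: "h \<in> H0" by (rule closed[OF X0 h])
  have h1: "sqn h \<le> 1" by (rule LIMSEQ_le_const2[OF tendsto_sqn[OF XH h]]) (use X1 in blast)
  \<comment> \<open>Continuity of the \<open>L2\<close> form in the norm of \<open>H\<close> carries
    near-maximality to the limit. Then \<mu> is at most \<open>?Q h\<close>, which is at most
    \<open>\<mu> * sqn h\<close> and hence at most \<mu>, so equality holds throughout.\<close>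
  have "?Q (X n) \<le> ?Q h + 2 * (c * sqrt (sqn (X n - h)) * sqrt (sqn h)) + c * sqn (X n - h)" for n
  proof -
    have d: "X n - h \<in> H" by (intro form.mem XH h)
    have "?Q ((X n - h) + h) = ?Q (X n - h) + 2 * Re (L2_ip M (X n - h) h) + ?Q h"
      by (rule L2.Re_add_self[OF d h(1)])
    moreover have "(X n - h) + h = X n" by (rule ext) simp
    moreover have "Re (L2_ip M (X n - h) h) \<le> c * sqrt (sqn (X n - h)) * sqrt (sqn h)"
      using c(2)[OF d h(1)] complex_Re_le_cmod by (rule order.trans[rotated])
    ultimately show ?thesis using Qc[OF d] by (simp only:)
  qed
  then have le_h: "\<mu> - 1 / Suc n \<le> ?Q h + 2 * (c * sqrt (sqn (X n - h)) * sqrt (sqn h)) + c * sqn (X n - h)" for n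
    using XQ[of n] by (meson less_imp_le order.trans)
  have l1: "(\<lambda>n. ?Q h + 2 * (c * sqrt (sqn (X n - h)) * sqrt (sqn h)) + c * sqn (X n - h)) \<longlonglongrightarrow>
      ?Q h + 2 * (c * sqrt 0 * sqrt (sqn h)) + c * 0"
    by (intro tendsto_intros h(2))
  have l2: "(\<lambda>n. \<mu> - 1 / Suc n) \<longlonglongrightarrow> \<mu> - 0"
    by (intro tendsto_intros LIMSEQ_Suc[OF lim_1_over_n])
  have "\<mu> - 0 \<le> ?Q h + 2 * (c * sqrt 0 * sqrt (sqn h)) + c * 0"
    using le_h by (intro LIMSEQ_le[OF l2 l1]) blast
  then have "\<mu> \<le> ?Q h" by simp
  moreover have "\<mu> * sqn h \<le> \<mu> * 1" using h1 mu by (intro mult_left_mono) auto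
  ultimately have eq: "?Q h = \<mu> * sqn h" using le[OF h0] by linarith
  have "h \<noteq> 0"
  proof
    assume "h = 0"
    then have "?Q h = 0" by (simp add: L2.zero_left form.mem_zero)
    with \<open>\<mu> \<le> ?Q h\<close> mu show False by simp
  qed
  with that mu h0 eq le show thesis by blast
qed

text \<open>If the orthogonal complement \<open>H0\<close> of the \<open>e k\<close> were nonzero, a
  maximizer of the Rayleigh quotient on it would be an eigenvector with a positive eigenvalue. The
  last clause of \<open>spectral_data\<close> puts it into the span of the \<open>e k\<close>, so it
  would be orthogonal to itself.\<close>

lemma eigenfunctions_complete:
  assumes f: "f \<in> H" "\<And>k. 1 \<le> k \<Longrightarrow> ip f (e k) = 0"
  shows "f = 0"
proof (rule ccontr)
  assume nz: "f \<noteq> 0"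
  define H0 where "H0 = {f \<in> H. \<forall>k\<ge>1. ip f (e k) = 0}"
  have sub: "cfun.subspace H0" "H0 \<subseteq> H"
    unfolding cfun.subspace_def H0_def
    by (auto simp: form.mem_zero form.zero_left e_mem form.mem_add form.add_left form.mem_scale form.scale_left)
  have closed: "g \<in> H0" if X: "\<And>n. X n \<in> H0" and g: "g \<in> H" "(\<lambda>n. sqn (X n - g)) \<longlonglongrightarrow> 0" for X g
  proof -
    have "ip g (e k) = 0" if k: "1 \<le> k" for k
    proof (rule LIMSEQ_unique)
      show "(\<lambda>n. ip (X n) (e k)) \<longlonglongrightarrow> ip g (e k)"
        using X sub(2) g e_mem[OF k] by (intro tendsto_ip) auto
      show "(\<lambda>n. ip (X n) (e k)) \<longlonglongrightarrow> 0" using X k by (simp add: H0_def)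
    qed
    then show ?thesis using g by (simp add: H0_def)
  qed
  have f0: "f \<in> H0" using f by (simp add: H0_def)
  obtain h \<mu> where mu: "0 < \<mu>" and h: "h \<in> H0" "h \<noteq> 0" "Re (L2_ip M h h) = \<mu> * sqn h"
    and le: "\<And>f. f \<in> H0 \<Longrightarrow> Re (L2_ip M f f) \<le> \<mu> * sqn f"
  proof (rule maximizer_exists[OF sub _ f0 nz])
    show "g \<in> H0" if "\<And>n. X n \<in> H0" "g \<in> H" "(\<lambda>n. sqn (X n - g)) \<longlonglongrightarrow> 0" for X g
      using that by (rule closed)
  qed blast
  have hH: "h \<in> H" using h sub by blast
  let ?T = "J_adjoint H ip M h"
  note T = J_adjoint_exists[OF hH]
  \<comment> \<open>The defect of the eigenvalue equation is itself the direction of variation. It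
    is admissible because \<open>ip w (e k)\<close> is a multiple of \<open>ip h (e k)\<close>,
    which is 0.\<close>
  define w where "w = ?T - cscale (of_real \<mu>) h"
  have wH: "w \<in> H" unfolding w_def by (intro form.mem T hH)
  have ipw: "ip w g = L2_ip M h g - of_real \<mu> * ip h g" if "g \<in> H" for g
    unfolding w_def using form.diff_left[OF T(1) form.mem_scale[OF hH] that] T(2)[OF that]
      form.scale_left[OF hH that] by simp
  have w0: "w \<in> H0"
  proof -
    have "ip w (e k) = 0" if k: "1 \<le> k" for k
      using ipw[OF e_mem[OF k]] L2_e_right[OF k hH] h(1) k by (simp add: H0_def)
    then show ?thesis using wH by (simp add: H0_def)
  qed
  have "\<mu> * Re (ip h w) - Re (L2_ip M h w) = 0"
  proof (rule quadratic_nonneg_imp_zero[of _ "\<mu> * sqn w - Re (L2_ip M w w)"])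
    fix t :: real
    have "h + cscale (of_real t) w \<in> H0" by (intro cfun.subspace_add cfun.subspace_scale sub h w0)
    from le[OF this] show "0 \<le> 2 * t * (\<mu> * Re (ip h w) - Re (L2_ip M h w)) + t\<^sup>2 * (\<mu> * sqn w - Re (L2_ip M w w))"
      unfolding form.Re_combination_self[OF hH wH] L2.Re_combination_self[OF hH wH] h(3)
      by (simp add: algebra_simps)
  qed
  \<comment> \<open>By \<open>ipw\<close>, the vanishing derivative is \<open>sqn w\<close> up to
    sign.\<close>
  then have "sqn w = 0" using ipw[OF wH] by simp
  then have "w = 0" using sqn_zero_iff[OF wH] by simp
  then have "?T = cscale (of_real \<mu>) h" by (simp add: w_def)
  then have hs: "h \<in> cfun.span (e ` {k. 1 \<le> k \<and> lam k = \<mu>})"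
    using hH eigenspace[OF mu] by blast
  have "cfun.subspace {g \<in> H. ip h g = 0}"
    unfolding cfun.subspace_def using hH
    by (auto simp: form.mem_zero form.zero_right form.mem_add form.add_right form.mem_scale form.scale_right)
  moreover have "e ` {k. 1 \<le> k \<and> lam k = \<mu>} \<subseteq> {g \<in> H. ip h g = 0}"
    using h(1) e_mem by (auto simp: H0_def)
  ultimately have "h \<in> {g \<in> H. ip h g = 0}" using cfun.span_minimal hs by blast
  then have "ip h h = 0" by simp
  then show False using ip_definite[OF hH] h(2) by simp
qed

section \<open>Expansion of the kernel in eigenfunctions\<close>

definition eigenset :: "nat \<Rightarrow> ('a \<Rightarrow> complex) set" where "eigenset m = e ` {1..m}"

lemma inj_on_e: "inj_on e {1..m}"
proof (rule inj_onI)
  fix i j assume ij: "i \<in> {1..m}" "j \<in> {1..m}" "e i = e j"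
  then have "ip (e i) (e j) = 1" using ip_e[of i i] by simp
  then show "i = j" using ip_e[of i j] ij by (auto split: if_splits)
qed

lemma eigenset_orthonormal: "orthonormal_set (eigenset m)"
  unfolding orthonormal_set_def eigenset_def
  using inj_on_e[of m] by (auto simp: e_mem ip_e inj_on_eq_iff)

lemma card_eigenset: "card (eigenset m) = m"
  unfolding eigenset_def card_image[OF inj_on_e] by simp

lemma power2_fun_eigenset:
  "power2_fun (eigenset m) x = sqn (ker x) - (\<Sum>k=1..m. (cmod (e k x))\<^sup>2)"
  unfolding power2_fun_def eigenset_def by (simp only: sum.reindex[OF inj_on_e] o_def)

text \<open>By Pythagoras the squared distance of two residuals is the difference of their squared
  norms, which decrease; so the residuals form a Cauchy sequence. The limit is orthogonal to every
  \<open>e k\<close>, hence 0 by completeness.\<close>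

lemma power2_fun_eigenset_tendsto:
  assumes x: "x \<in> D"
  shows "(\<lambda>m. power2_fun (eigenset m) x) \<longlonglongrightarrow> 0"
proof -
  define r where "r m = ker x - proj (eigenset m) (ker x)" for m
  have kx: "ker x \<in> H" by (rule kernel_in[OF x])
  have rH: "r m \<in> H" for m unfolding r_def by (intro form.mem proj_mem eigenset_orthonormal kx)
  have r2: "power2_fun (eigenset m) x = sqn (r m)" for m
    unfolding r_def by (rule power2_fun_eq[OF eigenset_orthonormal x])
  have r_orth: "ip (r m) (e k) = 0" if "1 \<le> k" "k \<le> m" for k m
    unfolding r_def using that by (intro ip_sub_proj eigenset_orthonormal kx) (auto simp: eigenset_def)
  have diff: "sqn (r m - r n) = sqn (r m) - sqn (r n)" if mn: "m \<le> n" for m n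
  proof -
    have rd: "r m - r n = proj (eigenset n) (ker x) - proj (eigenset m) (ker x)"
      unfolding r_def by (rule ext) simp
    have "cfun.span (eigenset m) \<subseteq> cfun.span (eigenset n)"
      using mn by (intro cfun.span_mono) (auto simp: eigenset_def)
    then have sp: "r m - r n \<in> cfun.span (eigenset n)"
      unfolding rd by (intro cfun.span_diff proj_span) (rule subsetD[OF _ proj_span])
    have "ip (r n) (r m - r n) = 0"
      using ip_sub_proj_span[OF eigenset_orthonormal kx sp] by (simp only: r_def)
    then have "ip (r n) (r m) = ip (r n) (r n)" using form.diff_right[OF rH[of m] rH[of n] rH[of n]] by simp
    then show ?thesis
      unfolding form.Re_diff_self[OF rH[of m] rH[of n]] form.Re_sym[OF rH[of n] rH[of m]] by simp
  qed
  have anti: "sqn (r n) \<le> sqn (r m)" if "m \<le> n" for m n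
    using diff[OF that] ip_nonneg[OF form.mem_diff[OF rH[of m] rH[of n]]] by linarith
  have "convergent (\<lambda>m. sqn (r m))"
    using anti ip_nonneg[OF rH]
    by (intro Bseq_monoseq_convergent BseqI'[where K = "sqn (r 0)"] decseq_imp_monoseq)
      (auto simp: decseq_def)
  then have cau: "Cauchy (\<lambda>m. sqn (r m))" by (rule convergent_Cauchy)
  have "\<exists>N. \<forall>m\<ge>N. \<forall>n\<ge>N. sqn (r m - r n) < \<epsilon>" if pos: "0 < \<epsilon>" for \<epsilon>
  proof -
    obtain N where N: "\<And>m n. m \<ge> N \<Longrightarrow> n \<ge> N \<Longrightarrow> \<bar>sqn (r m) - sqn (r n)\<bar> < \<epsilon>"
      using CauchyD[OF cau pos] by auto
    have "sqn (r m - r n) < \<epsilon>" if "m \<ge> N" "n \<ge> N" for m n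
    proof (cases "m \<le> n")
      case True
      show ?thesis using diff[OF True] N[OF that] by linarith
    next
      case False
      have "sqn (r m - r n) = sqn (r n - r m)"
        unfolding form.Re_diff_self[OF rH[of m] rH[of n]] form.Re_diff_self[OF rH[of n] rH[of m]]
          form.Re_sym[OF rH[of n] rH[of m]] by simp
      then show ?thesis using diff[of n m] False N[OF that] by linarith
    qed
    then show ?thesis by blast
  qed
  then obtain f where f: "f \<in> H" "(\<lambda>m. sqn (r m - f)) \<longlonglongrightarrow> 0"
    using complete_sqn[of r] rH by blast
  have "ip f (e k) = 0" if k: "1 \<le> k" for k
  proof (rule LIMSEQ_unique)
    show "(\<lambda>m. ip (r m) (e k)) \<longlonglongrightarrow> ip f (e k)" by (rule tendsto_ip[OF rH f(1) e_mem[OF k] f(2)])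
    have "\<forall>\<^sub>F m in sequentially. ip (r m) (e k) = 0"
      using r_orth[OF k] by (auto simp: eventually_sequentially)
    then show "(\<lambda>m. ip (r m) (e k)) \<longlonglongrightarrow> 0" by (rule tendsto_eventually)
  qed
  then have "f = 0" by (rule eigenfunctions_complete[OF f(1)])
  with tendsto_sqn[OF rH f] show ?thesis unfolding r2 by (simp add: form.zero_left form.mem_zero)
qed

end

section \<open>Decay of the power function of the eigenspaces\<close>

context spectral_rkhs
begin

lemma D_nonempty: "D \<noteq> {}"
proof
  assume "D = {}"
  then have "e 1 = 0" using vanish[OF e_mem[of 1]] by (auto simp: fun_eq_iff)
  then show False using ip_e[of 1 1] form.zero_left[OF form.mem_zero] by simp
qed

lemma e_bounded:
  assumes "\<And>x. x \<in> D \<Longrightarrow> sqn (ker x) \<le> s0\<^sup>2" "0 \<le> s0" "1 \<le> k" "x \<in> D"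
  shows "cmod (e k x) \<le> s0"
  using value_le_bound[OF assms(1,2) e_mem[OF assms(3)] assms(4)] ip_e[of k k] assms(3) by simp

lemma eta_sq:
  assumes "1 \<le> k"
  shows "(cmod (e k x))\<^sup>2 = lam k * (cmod (eta lam e k x))\<^sup>2"
  using lam_pos[OF assms]
  by (simp add: eta_def cscale_apply sing_number_def norm_mult power_mult_distrib norm_inverse power_inverse)

text \<open>The real supremum is an upper bound only of a bounded set; here each summand is at most
  the square of \<open>s0\<close> divided by \<open>lam k\<close>.\<close>

lemma sum_eta_le:
  assumes "x \<in> D"
  shows "(\<Sum>k\<in>{1..<m}. (cmod (eta lam e k x))\<^sup>2) \<le> spectral_function D lam e m"
  unfolding spectral_function_def
proof (rule cSUP_upper[OF assms])
  obtain s0 where s0: "0 \<le> s0" "\<And>x. x \<in> D \<Longrightarrow> sqn (ker x) \<le> s0\<^sup>2" using sqn_ker_bound by metis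
  show "bdd_above ((\<lambda>x. \<Sum>k\<in>{1..<m}. (cmod (eta lam e k x))\<^sup>2) ` D)"
  proof (rule bdd_aboveI2)
    fix x assume x: "x \<in> D"
    show "(\<Sum>k\<in>{1..<m}. (cmod (eta lam e k x))\<^sup>2) \<le> (\<Sum>k\<in>{1..<m}. s0\<^sup>2 / lam k)"
    proof (rule sum_mono)
      fix k assume k: "k \<in> {1..<m}"
      then have k1: "1 \<le> k" by simp
      have "(cmod (e k x))\<^sup>2 \<le> s0\<^sup>2" using e_bounded[OF s0(2,1) k1 x] by (intro power_mono) auto
      then show "(cmod (eta lam e k x))\<^sup>2 \<le> s0\<^sup>2 / lam k"
        using lam_pos[OF k1] by (simp add: eta_sq[OF k1] field_simps)
    qed
  qed
qed

lemma spectral_function_nonneg: "0 \<le> spectral_function D lam e m"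
proof -
  obtain x where "x \<in> D" using D_nonempty by blast
  from sum_eta_le[OF this, of m] show ?thesis by (meson order.trans sum_nonneg zero_le_power2)
qed

text \<open>The eventual bound becomes uniform by adding the ratios of the finitely many early
  terms; the one for \<open>m = 0\<close> is a division by zero and counts as 0.\<close>

lemma spectral_growth_bound:
  assumes "spectral_growth D lam e u"
  obtains C where "0 \<le> C" "\<And>m. 1 \<le> m \<Longrightarrow> spectral_function D lam e m \<le> C * real m powr u"
proof -
  let ?N = "spectral_function D lam e"
  obtain c where c: "0 < c" "\<forall>\<^sub>F m in sequentially. norm (?N m) \<le> c * norm (real m powr u)"
    using assms unfolding spectral_growth_def by (elim landau_o.bigE)
  then obtain m0 where m0: "\<And>m. m \<ge> m0 \<Longrightarrow> ?N m \<le> c * real m powr u"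
    by (auto simp: eventually_sequentially spectral_function_nonneg)
  let ?S = "\<Sum>m\<le>m0. ?N m / real m powr u"
  have S: "0 \<le> ?S" by (intro sum_nonneg divide_nonneg_nonneg spectral_function_nonneg) auto
  have "?N m \<le> (c + ?S) * real m powr u" if m: "1 \<le> m" for m
  proof (cases "m \<ge> m0")
    case True
    have "c * real m powr u \<le> (c + ?S) * real m powr u" using S by (intro mult_right_mono) auto
    with m0[OF True] show ?thesis by linarith
  next
    case False
    have "?N m / real m powr u \<le> ?S"
      using False by (intro member_le_sum divide_nonneg_nonneg spectral_function_nonneg) auto
    then have "?N m / real m powr u \<le> c + ?S" using c by linarith
    then show ?thesis using m by (simp add: pos_divide_le_eq)
  qed
  moreover have "0 \<le> c + ?S" using c(1) S by linarith
  ultimately show thesis using that by blast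
qed

text \<open>On a block \<open>lam k\<close> is at most \<open>lam (2 ^ i)\<close>, of order
  \<open>2 powr (- 2 * p * i)\<close>, and the squares of the normalized eigenfunctions sum to at
  most the spectral function, of order \<open>2 powr (u * i)\<close>.\<close>

lemma eigenfunction_block_bound:
  assumes "sing_decay lam p" "spectral_growth D lam e u"
  obtains A where "0 \<le> A" "\<And>i x. x \<in> D \<Longrightarrow>
    (\<Sum>k\<in>{2 ^ i<..2 ^ Suc i}. (cmod (e k x))\<^sup>2) \<le> A * (2 powr (u - 2 * p)) ^ i"
proof -
  obtain C1 where C1: "0 \<le> C1" "\<And>m. 1 \<le> m \<Longrightarrow> spectral_function D lam e m \<le> C1 * real m powr u"
    using spectral_growth_bound[OF assms(2)] by metis
  obtain C2 where C2: "0 < C2" "\<And>j. 1 \<le> j \<Longrightarrow> sing_number lam j \<le> C2 * real j powr (- p)"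
    using assms(1) unfolding sing_decay_def by blast
  have "(\<Sum>k\<in>{2 ^ i<..2 ^ Suc i}. (cmod (e k x))\<^sup>2) \<le> (C2\<^sup>2 * (C1 * 4 powr \<bar>u\<bar>)) * (2 powr (u - 2 * p)) ^ i"
    if x: "x \<in> D" for i x
  proof -
    have pi: "(1::nat) \<le> 2 ^ i" by simp
    have lp: "0 < lam (2 ^ i)" by (rule lam_pos[OF pi])
    have "lam (2 ^ i) = (sing_number lam (2 ^ i))\<^sup>2" using lp by (simp add: sing_number_def)
    also have "\<dots> \<le> (C2 * real (2 ^ i) powr (- p))\<^sup>2"
      using C2(2)[OF pi] lp by (intro power_mono) (auto simp: sing_number_def)
    also have "\<dots> = C2\<^sup>2 * 2 powr (- 2 * p * real i)"
      by (simp add: power_mult_distrib power2_eq_square powr_realpow[symmetric] powr_powr powr_add[symmetric]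
          mult.assoc)
    finally have lam_le: "lam (2 ^ i) \<le> C2\<^sup>2 * 2 powr (- 2 * p * real i)" .
    \<comment> \<open>The spectral function at \<open>m\<close> stops at \<open>m - 1\<close>, hence
      the argument \<open>2 ^ Suc i + 1\<close>. It is \<open>2 ^ i\<close> times a factor
      \<open>t\<close> between 1 and 4; the absolute value of \<open>u\<close> covers both signs of
      \<open>u\<close>.\<close>
    define t where "t = real (2 ^ Suc i + 1) / 2 ^ i"
    have "(1::real) \<le> 2 ^ i" "real (2 ^ Suc i + 1) = 2 * 2 ^ i + 1" by simp_all
    then have "1 * 2 ^ i \<le> real (2 ^ Suc i + 1)" "real (2 ^ Suc i + 1) \<le> 4 * 2 ^ i" by linarith+
    then have t: "1 \<le> t" "t \<le> 4" unfolding t_def by (simp_all only: pos_le_divide_eq pos_divide_le_eq zero_less_power zero_less_numeral)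
    have "t powr u \<le> t powr \<bar>u\<bar>" using t by (intro powr_mono) auto
    also have "\<dots> \<le> 4 powr \<bar>u\<bar>" using t by (intro powr_mono2) auto
    finally have tu: "t powr u \<le> 4 powr \<bar>u\<bar>" .
    have "real (2 ^ Suc i + 1) = 2 powr real i * t"
      unfolding t_def by (simp add: powr_realpow)
    then have "real (2 ^ Suc i + 1) powr u = 2 powr (u * real i) * t powr u"
      using t by (simp only: powr_mult powr_powr mult.commute)
    also have "\<dots> \<le> 2 powr (u * real i) * 4 powr \<bar>u\<bar>" using tu by (intro mult_left_mono) auto
    finally have mu: "real (2 ^ Suc i + 1) powr u \<le> 2 powr (u * real i) * 4 powr \<bar>u\<bar>" .
    have "(\<Sum>k\<in>{2 ^ i<..2 ^ Suc i}. (cmod (e k x))\<^sup>2)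
        \<le> (\<Sum>k\<in>{2 ^ i<..2 ^ Suc i}. lam (2 ^ i) * (cmod (eta lam e k x))\<^sup>2)"
    proof (rule sum_mono)
      fix k :: nat assume k: "k \<in> {2 ^ i<..2 ^ Suc i}"
      then have k1: "1 \<le> k" "2 ^ i \<le> k" by auto
      show "(cmod (e k x))\<^sup>2 \<le> lam (2 ^ i) * (cmod (eta lam e k x))\<^sup>2"
        unfolding eta_sq[OF k1(1)] using lam_antimono[OF pi k1(2)] by (intro mult_right_mono) auto
    qed
    also have "\<dots> = lam (2 ^ i) * (\<Sum>k\<in>{2 ^ i<..2 ^ Suc i}. (cmod (eta lam e k x))\<^sup>2)"
      by (rule sum_distrib_left[symmetric])
    also have "\<dots> \<le> lam (2 ^ i) * (\<Sum>k\<in>{1..<2 ^ Suc i + 1}. (cmod (eta lam e k x))\<^sup>2)"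
      using lp by (intro mult_left_mono sum_mono2) auto
    also have "\<dots> \<le> lam (2 ^ i) * spectral_function D lam e (2 ^ Suc i + 1)"
      using lp by (intro mult_left_mono sum_eta_le x) auto
    also have "\<dots> \<le> (C2\<^sup>2 * 2 powr (- 2 * p * real i)) * (C1 * (2 powr (u * real i) * 4 powr \<bar>u\<bar>))"
    proof (rule mult_mono[OF lam_le])
      have "spectral_function D lam e (2 ^ Suc i + 1) \<le> C1 * real (2 ^ Suc i + 1) powr u" by (rule C1(2)) simp
      also have "\<dots> \<le> C1 * (2 powr (u * real i) * 4 powr \<bar>u\<bar>)" by (rule mult_left_mono[OF mu C1(1)])
      finally show "spectral_function D lam e (2 ^ Suc i + 1) \<le> C1 * (2 powr (u * real i) * 4 powr \<bar>u\<bar>)" .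
    qed (auto simp: spectral_function_nonneg)
    also have "\<dots> = (C2\<^sup>2 * (C1 * 4 powr \<bar>u\<bar>)) * (2 powr (u * real i) * 2 powr (- 2 * p * real i))"
      by (simp only: mult_ac)
    also have "2 powr (u * real i) * 2 powr (- 2 * p * real i) = (2 powr (u - 2 * p)) powr real i"
      by (simp add: powr_add[symmetric] powr_powr left_diff_distrib)
    also have "\<dots> = (2 powr (u - 2 * p)) ^ i" by (simp add: powr_realpow)
    finally show ?thesis .
  qed
  then show thesis using that[of "C2\<^sup>2 * (C1 * 4 powr \<bar>u\<bar>)"] C1(1) by simp
qed

text \<open>As the power function tends to 0, it is bounded by the blocks still to come. They form a
  geometric series, convergent by \<open>u < 2 * p\<close>, and the square root halves its exponent
  to \<open>p - u / 2\<close>.\<close>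

lemma eigenset_power_decay:
  assumes "sing_decay lam p" "spectral_growth D lam e u" "u < 2 * p"
  obtains C where "0 \<le> C" "\<And>j x. x \<in> D \<Longrightarrow>
    power2_fun (eigenset (2 ^ j)) x \<le> (C * 2 powr (- (p - u / 2) * real j))\<^sup>2"
proof -
  obtain A where A: "0 \<le> A" "\<And>i x. x \<in> D \<Longrightarrow>
    (\<Sum>k\<in>{2 ^ i<..2 ^ Suc i}. (cmod (e k x))\<^sup>2) \<le> A * (2 powr (u - 2 * p)) ^ i"
    using eigenfunction_block_bound[OF assms(1,2)] by metis
  define \<rho> where "\<rho> = 2 powr (u - 2 * p)"
  have rho: "0 < \<rho>" "\<rho> < 1" using assms(3) powr_less_mono[of "u - 2 * p" 0 2] by (auto simp: \<rho>_def)
  \<comment> \<open>With this \<open>G\<close> the bound of block \<open>i\<close> is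
    \<open>G * (\<rho> ^ i - \<rho> ^ Suc i)\<close>, so the sum telescopes.\<close>
  define G where "G = A / (1 - \<rho>)"
  have G: "0 \<le> G" "G * (1 - \<rho>) = A" using A(1) rho by (auto simp: G_def)
  have bound: "power2_fun (eigenset (2 ^ j)) x \<le> (sqrt G * 2 powr (- (p - u / 2) * real j))\<^sup>2" if x: "x \<in> D" for j x
  proof -
    let ?P = "\<lambda>i. power2_fun (eigenset (2 ^ i)) x"
    have step: "?P i \<le> ?P (Suc i) + A * \<rho> ^ i" for i
    proof -
      have "{1..2 ^ Suc i} = {1..2 ^ i} \<union> {2 ^ i<..2 ^ Suc i :: nat}" by (auto simp: not_le)
      then have "(\<Sum>k=1..2 ^ Suc i. (cmod (e k x))\<^sup>2)
          = (\<Sum>k=1..2 ^ i. (cmod (e k x))\<^sup>2) + (\<Sum>k\<in>{2 ^ i<..2 ^ Suc i}. (cmod (e k x))\<^sup>2)"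
        by (simp only:) (intro sum.union_disjoint, auto)
      with A(2)[OF x, of i] show ?thesis unfolding power2_fun_eigenset \<rho>_def by linarith
    qed
    have tele: "?P j \<le> ?P (j + n) + G * (\<rho> ^ j - \<rho> ^ (j + n))" for n
    proof (induction n)
      case (Suc n)
      have "A * \<rho> ^ (j + n) = G * (\<rho> ^ (j + n) - \<rho> ^ (j + Suc n))"
        unfolding G(2)[symmetric] by (simp add: algebra_simps)
      with Suc.IH step[of "j + n"] show ?case by (simp add: algebra_simps)
    qed simp
    have le: "?P j \<le> ?P (j + n) + G * \<rho> ^ j" for n
    proof -
      have "G * (\<rho> ^ j - \<rho> ^ (j + n)) \<le> G * \<rho> ^ j" using G(1) rho by (intro mult_left_mono) auto
      with tele[of n] show ?thesis by linarith
    qed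
    have "filterlim (\<lambda>n. 2 ^ (j + n) :: nat) at_top sequentially"
      by (rule filterlim_subseq) (auto simp: strict_mono_def)
    then have "(\<lambda>n. ?P (j + n)) \<longlonglongrightarrow> 0" by (rule filterlim_compose[OF power2_fun_eigenset_tendsto[OF x]])
    then have "(\<lambda>n. ?P (j + n) + G * \<rho> ^ j) \<longlonglongrightarrow> 0 + G * \<rho> ^ j" by (intro tendsto_intros)
    then have "?P j \<le> 0 + G * \<rho> ^ j" by (rule LIMSEQ_le_const) (use le in blast)
    also have "0 + G * \<rho> ^ j = (sqrt G * 2 powr (- (p - u / 2) * real j))\<^sup>2"
    proof -
      have "\<rho> ^ j = 2 powr ((u - 2 * p) * real j)" unfolding \<rho>_def by (simp add: powr_realpow[symmetric] powr_powr)
      also have "(u - 2 * p) * real j = - (p - u / 2) * real j + - (p - u / 2) * real j" by (simp add: algebra_simps)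
      finally have "\<rho> ^ j = (2 powr (- (p - u / 2) * real j))\<^sup>2" by (simp only: powr_add power2_eq_square)
      then show ?thesis using G(1) by (simp add: power_mult_distrib)
    qed
    finally show ?thesis .
  qed
  show thesis by (rule that[OF real_sqrt_ge_zero[OF G(1)] bound])
qed

text \<open>Condition (i') enters the proof through this implication alone.\<close>

lemma spectral_growth_bounded_eta:
  assumes "0 < C" "\<And>j. 1 \<le> j \<Longrightarrow> sup_norm D (eta lam e j) \<le> ennreal C"
  shows "spectral_growth D lam e 1"
  unfolding spectral_growth_def
proof (rule bigoI[of _ "C\<^sup>2"], rule always_eventually, rule allI)
  fix m
  have "spectral_function D lam e m \<le> C\<^sup>2 * real m"
    unfolding spectral_function_def
  proof (rule cSUP_least[OF D_nonempty])
    fix x assume x: "x \<in> D"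
    have "(\<Sum>k\<in>{1..<m}. (cmod (eta lam e k x))\<^sup>2) \<le> (\<Sum>k\<in>{1..<m}. C\<^sup>2)"
    proof (rule sum_mono)
      fix k assume "k \<in> {1..<m}"
      then have "ennreal (cmod (eta lam e k x)) \<le> ennreal C"
        using assms(2)[of k] SUP_upper[OF x, of "\<lambda>x. ennreal (cmod (eta lam e k x))"]
        unfolding sup_norm_def by auto
      then show "(cmod (eta lam e k x))\<^sup>2 \<le> C\<^sup>2"
        using assms(1) by (intro power_mono) (auto simp: ennreal_le_iff)
    qed
    also have "\<dots> \<le> C\<^sup>2 * real m" by (simp add: mult.commute mult_right_mono)
    finally show "(\<Sum>k\<in>{1..<m}. (cmod (eta lam e k x))\<^sup>2) \<le> C\<^sup>2 * real m" .
  qed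
  then show "norm (spectral_function D lam e m) \<le> C\<^sup>2 * norm (real m powr 1)"
    by (simp add: spectral_function_nonneg)
qed

lemma optimal_orders_ge_spectral:
  assumes "sing_decay lam p" "spectral_growth D lam e u" "u < 2 * p"
  shows "ereal (p - u / 2) \<le> q_std D H ip" "ereal (p - u / 2) \<le> q_lin D H ip"
proof -
  obtain s0 where s0: "0 \<le> s0" "\<And>x. x \<in> D \<Longrightarrow> sqn (ker x) \<le> s0\<^sup>2" using sqn_ker_bound by metis
  obtain C where C: "0 \<le> C" "\<And>j x. x \<in> D \<Longrightarrow>
    power2_fun (eigenset (2 ^ j)) x \<le> (C * 2 powr (- (p - u / 2) * real j))\<^sup>2"
    using eigenset_power_decay[OF assms] by metis
  have pos: "0 < p - u / 2" using assms(3) by simp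
  from optimal_orders_ge[OF s0(2,1) D_nonempty pos C(1) eigenset_orthonormal _ C(2)]
  show "ereal (p - u / 2) \<le> q_std D H ip" "ereal (p - u / 2) \<le> q_lin D H ip"
    by (simp_all add: card_eigenset)
qed

end

section \<open>Lower bounds\<close>

text \<open>Gaussian elimination, with each element of \<open>F\<close> as the coefficient row of an
  equation. Rows that become equal only shrink the set.\<close>

lemma underdetermined_system:
  fixes F :: "('i \<Rightarrow> complex) set"
  assumes "finite F" "finite I" "card F < card I"
  shows "\<exists>c. (\<exists>i\<in>I. c i \<noteq> 0) \<and> (\<forall>\<phi>\<in>F. (\<Sum>i\<in>I. c i * \<phi> i) = 0)"
  using assms
proof (induction "card F" arbitrary: F I rule: less_induct)
  case less
  show ?case
  proof (cases "\<forall>\<phi>\<in>F. \<forall>i\<in>I. \<phi> i = 0")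
    case True
    have "I \<noteq> {}" using less.prems by auto
    then show ?thesis using True by (intro exI[of _ "\<lambda>_. 1"]) auto
  next
    case False
    then obtain \<phi> j where j: "\<phi> \<in> F" "j \<in> I" "\<phi> j \<noteq> 0" by blast
    \<comment> \<open>The row \<psi> with the unknown \<open>j\<close> eliminated by the pivot
      \<open>\<phi> j\<close>.\<close>
    define r where "r \<psi> i = \<psi> i - \<psi> j / \<phi> j * \<phi> i" for \<psi> :: "'i \<Rightarrow> complex" and i
    let ?I = "I - {j}" and ?F = "r ` (F - {\<phi>})"
    have cF: "card ?F \<le> card F - 1"
      using card_image_le[of "F - {\<phi>}" r] less.prems(1) j(1) by simp
    have c0: "0 < card F" using less.prems(1) j(1) card_gt_0_iff by blast
    have "card ?I = card I - 1" using less.prems(2) j(2) by simp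
    then have "card ?F < card ?I" using cF c0 less.prems(3) by linarith
    moreover have "card ?F < card F" using cF c0 by linarith
    ultimately obtain c where c: "\<exists>i\<in>?I. c i \<noteq> 0" "\<And>\<psi>. \<psi> \<in> F - {\<phi>} \<Longrightarrow> (\<Sum>i\<in>?I. c i * r \<psi> i) = 0"
      using less.hyps[of ?F ?I] less.prems(1,2) by auto
    define s where "s \<psi> = (\<Sum>i\<in>?I. c i * \<psi> i)" for \<psi>
    \<comment> \<open>Back substitution: the value at \<open>j\<close> is the one that solves the
      equation \<phi>.\<close>
    define d where "d = c(j := - s \<phi> / \<phi> j)"
    have dsum: "(\<Sum>i\<in>I. d i * \<psi> i) = - s \<phi> / \<phi> j * \<psi> j + s \<psi>" for \<psi>
    proof -
      have "(\<Sum>i\<in>I. d i * \<psi> i) = d j * \<psi> j + (\<Sum>i\<in>?I. d i * \<psi> i)"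
        by (rule sum.remove[OF less.prems(2) j(2)])
      also have "(\<Sum>i\<in>?I. d i * \<psi> i) = s \<psi>" unfolding s_def d_def by (intro sum.cong) auto
      finally show ?thesis by (simp add: d_def)
    qed
    have "(\<Sum>i\<in>I. d i * \<psi> i) = 0" if \<psi>: "\<psi> \<in> F" for \<psi>
    proof (cases "\<psi> = \<phi>")
      case True
      then show ?thesis using j(3) by (simp add: dsum)
    next
      case False
      have "0 = (\<Sum>i\<in>?I. c i * \<psi> i - \<psi> j / \<phi> j * (c i * \<phi> i))"
        using c(2)[of \<psi>] \<psi> False by (simp add: r_def algebra_simps)
      also have "\<dots> = s \<psi> - \<psi> j / \<phi> j * s \<phi>"
        unfolding s_def sum_subtractf sum_distrib_left ..
      finally show ?thesis by (simp add: dsum)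
    qed
    moreover have "\<exists>i\<in>I. d i \<noteq> 0" using c(1) by (auto simp: d_def)
    ultimately show ?thesis by blast
  qed
qed

lemma linear_map_on_sum:
  assumes "linear_map_on V A" "cfun.subspace V" "\<And>i. i \<in> I \<Longrightarrow> f i \<in> V"
  shows "A (\<Sum>i\<in>I. cscale (c i) (f i)) = (\<Sum>i\<in>I. cscale (c i) (A (f i)))"
proof -
  have A0: "A 0 = 0"
    using assms(1) cfun.subspace_0[OF assms(2)] unfolding linear_map_on_def
    by (metis cfun.scale_zero_left)
  show ?thesis
    using assms(3)
  proof (induction I rule: infinite_finite_induct)
    case (insert i I)
    have "(\<Sum>i\<in>I. cscale (c i) (f i)) \<in> V" "cscale (c i) (f i) \<in> V"
      using insert.prems by (auto intro!: cfun.subspace_sum cfun.subspace_scale assms(2))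
    then have "A (cscale (c i) (f i) + (\<Sum>i\<in>I. cscale (c i) (f i)))
        = cscale (c i) (A (f i)) + A (\<Sum>i\<in>I. cscale (c i) (f i))"
      using assms(1) insert.prems unfolding linear_map_on_def by auto
    moreover have "A (\<Sum>i\<in>I. cscale (c i) (f i)) = (\<Sum>i\<in>I. cscale (c i) (A (f i)))"
      using insert by blast
    ultimately show ?case unfolding sum.insert[OF insert.hyps(1,2)] by (simp only:)
  qed (simp_all add: A0)
qed

context spectral_rkhs
begin

text \<open>There are \<open>2 * n\<close> free coefficients. Annihilation by \<open>A\<close>
  imposes at most \<open>n\<close> linear conditions, and orthogonality to the functions found
  before fewer than \<open>n\<close> more, so a nonzero solution remains at each step.\<close>

lemma kernel_orthonormal_set:
  assumes A: "linear_map_on H A" "A ` H \<subseteq> cfun.span B" "finite B" "card B \<le> n"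
  shows "j \<le> n \<Longrightarrow> \<exists>S. orthonormal_set S \<and> card S = j \<and> S \<subseteq> cfun.span (eigenset (2 * n)) \<and> (\<forall>v\<in>S. A v = 0)"
proof (induction j)
  case 0
  show ?case by (intro exI[of _ "{}"]) (simp add: orthonormal_set_def)
next
  case (Suc j)
  then obtain S where S: "orthonormal_set S" "card S = j" "S \<subseteq> cfun.span (eigenset (2 * n))"
    "\<And>v. v \<in> S \<Longrightarrow> A v = 0" using Suc_leD by blast
  let ?I = "{1..2 * n}"
  have eH: "e i \<in> H" if "i \<in> ?I" for i using that e_mem by simp
  have "\<exists>u. A (e i) = (\<Sum>b\<in>B. cscale (u b) b)" if "i \<in> ?I" for i
    using A(2) eH[OF that] unfolding cfun.span_finite[OF A(3)] by blast
  then obtain u where u: "\<And>i. i \<in> ?I \<Longrightarrow> A (e i) = (\<Sum>b\<in>B. cscale (u i b) b)" by metis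
  define F where "F = (\<lambda>b i. u i b) ` B \<union> (\<lambda>v i. ip (e i) v) ` S"
  have finS: "finite S" by (rule orthonormal_setD(1)[OF S(1)])
  have "card F \<le> card ((\<lambda>b i. u i b) ` B) + card ((\<lambda>v i. ip (e i) v) ` S)"
    unfolding F_def by (rule card_Un_le)
  also have "\<dots> \<le> card B + card S" by (intro add_mono card_image_le A(3) finS)
  also have "\<dots> < card ?I" using A(4) S(2) Suc.prems by simp
  finally have "card F < card ?I" .
  moreover have "finite F" unfolding F_def using A(3) finS by simp
  ultimately obtain c where c: "\<exists>i\<in>?I. c i \<noteq> 0" "\<And>\<phi>. \<phi> \<in> F \<Longrightarrow> (\<Sum>i\<in>?I. c i * \<phi> i) = 0"
    using underdetermined_system[of F ?I] by blast
  define v where "v = (\<Sum>i\<in>?I. cscale (c i) (e i))"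
  have vH: "v \<in> H" unfolding v_def by (intro form.mem eH)
  have vs: "v \<in> cfun.span (eigenset (2 * n))"
    unfolding v_def eigenset_def by (intro cfun.span_sum cfun.span_scale cfun.span_base) auto
  have "A v = (\<Sum>i\<in>?I. cscale (c i) (A (e i)))"
    unfolding v_def by (rule linear_map_on_sum[OF A(1) subspace eH])
  also have "\<dots> = (\<Sum>i\<in>?I. cscale (c i) (\<Sum>b\<in>B. cscale (u i b) b))"
    using u by (intro sum.cong refl) simp
  also have "\<dots> = (\<Sum>i\<in>?I. \<Sum>b\<in>B. cscale (c i * u i b) b)"
    by (simp only: cfun.scale_sum_right cfun.scale_scale)
  also have "\<dots> = (\<Sum>b\<in>B. cscale (\<Sum>i\<in>?I. c i * u i b) b)"
    unfolding cfun.scale_sum_left by (rule sum.swap)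
  also have "\<dots> = 0"
  proof (rule sum.neutral, rule ballI)
    fix b assume "b \<in> B"
    then have "(\<Sum>i\<in>?I. c i * u i b) = 0" using c(2)[of "\<lambda>i. u i b"] by (auto simp: F_def)
    then show "cscale (\<Sum>i\<in>?I. c i * u i b) b = 0" by (simp only: cfun.scale_zero_left)
  qed
  finally have Av: "A v = 0" .
  have ip_sum: "ip v g = (\<Sum>i\<in>?I. c i * ip (e i) g)" if "g \<in> H" for g
  proof -
    have "ip v g = (\<Sum>i\<in>?I. ip (cscale (c i) (e i)) g)"
      unfolding v_def by (intro form.sum_left form.mem eH that)
    also have "\<dots> = (\<Sum>i\<in>?I. c i * ip (e i) g)"
      by (intro sum.cong refl form.scale_left eH that)
    finally show ?thesis .
  qed
  have v_orth: "ip v q = 0" if "q \<in> S" for q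
    using ip_sum[OF orthonormal_setD(3)[OF S(1) that]] c(2)[of "\<lambda>i. ip (e i) q"] that
    by (auto simp: F_def)
  have "v \<noteq> 0"
  proof
    assume v0: "v = 0"
    obtain i where i: "i \<in> ?I" "c i \<noteq> 0" using c(1) by blast
    have "0 = ip v (e i)" using form.zero_left[OF eH[OF i(1)]] by (simp add: v0)
    also have "\<dots> = (\<Sum>k\<in>?I. if k = i then c k else 0)"
      unfolding ip_sum[OF eH[OF i(1)]] using i(1) by (intro sum.cong refl) (simp add: ip_e)
    also have "\<dots> = c i" using i(1) by simp
    finally show False using i(2) by simp
  qed
  note n = sqn_normalized[OF vH this]
  define w where "w = cscale (of_real (1 / sqrt (sqn v))) v"
  have wH: "w \<in> H" unfolding w_def by (rule form.mem_scale[OF vH])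
  have w_orth: "ip w q = 0" if "q \<in> S" for q
    unfolding w_def form.scale_left[OF vH orthonormal_setD(3)[OF S(1) that]] v_orth[OF that] by simp
  have w1: "sqn w = 1" unfolding w_def by (rule n(1))
  note ins = orthonormal_set_insert[OF S(1) wH w_orth w1]
  have "A w = cscale (of_real (1 / sqrt (sqn v))) (A v)"
    unfolding w_def using A(1) vH by (simp add: linear_map_on_def)
  then have "A w = 0" by (simp only: Av cfun.scale_zero_right)
  moreover have "w \<in> cfun.span (eigenset (2 * n))" unfolding w_def by (intro cfun.span_scale vs)
  ultimately show ?case
    using ins S finS by (intro exI[of _ "insert w S"]) (simp add: zero_fun_def)
qed

text \<open>On this span the \<open>L2\<close> form is diagonal in the \<open>e k\<close>, with
  entries \<open>lam k\<close> that are at least \<open>lam m\<close>.\<close>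

lemma L2_lower_bound:
  assumes m: "1 \<le> m" and v: "v \<in> cfun.span (eigenset m)"
  shows "lam m * sqn v \<le> Re (L2_ip M v v)"
proof -
  note E = eigenset_orthonormal[of m]
  have vH: "v \<in> H" using v form.mem_span[OF orthonormal_setD(2)[OF E]] by blast
  have v_eq: "v = (\<Sum>q\<in>eigenset m. cscale (ip v q) q)" using span_coefficients[OF E v] by (simp add: proj_def)
  have sq: "sqn v = (\<Sum>q\<in>eigenset m. (cmod (ip v q))\<^sup>2)"
    using sqn_combination[OF E, of "ip v"] v_eq by simp
  have qH: "q \<in> H" if "q \<in> eigenset m" for q using that orthonormal_setD[OF E] by blast
  have "L2_ip M v v = L2_ip M (\<Sum>q\<in>eigenset m. cscale (ip v q) q) v" using v_eq by simp
  also have "\<dots> = (\<Sum>q\<in>eigenset m. L2_ip M (cscale (ip v q) q) v)"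
    by (intro L2.sum_left form.mem_scale qH vH)
  finally have "Re (L2_ip M v v) = (\<Sum>q\<in>eigenset m. Re (L2_ip M (cscale (ip v q) q) v))" by simp
  also have "\<dots> \<ge> (\<Sum>q\<in>eigenset m. lam m * (cmod (ip v q))\<^sup>2)"
  proof (rule sum_mono)
    fix q assume q: "q \<in> eigenset m"
    then obtain k where k: "1 \<le> k" "k \<le> m" "q = e k" by (auto simp: eigenset_def)
    have "L2_ip M (cscale (ip v q) q) v = ip v q * (of_real (lam k) * ip q v)"
      unfolding L2.scale_left[OF qH[OF q] vH] using L2_e[OF k(1) vH] k(3) by simp
    also have "ip q v = cnj (ip v q)" by (rule form.conj_sym[OF vH qH[OF q]])
    also have "ip v q * (of_real (lam k) * cnj (ip v q)) = of_real (lam k) * (ip v q * cnj (ip v q))"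
      by (simp only: mult_ac)
    also have "\<dots> = of_real (lam k * (cmod (ip v q))\<^sup>2)"
      by (simp only: complex_norm_square of_real_mult)
    finally have "Re (L2_ip M (cscale (ip v q) q) v) = lam k * (cmod (ip v q))\<^sup>2" by simp
    then show "lam m * (cmod (ip v q))\<^sup>2 \<le> Re (L2_ip M (cscale (ip v q) q) v)"
      using lam_antimono[OF k(1,2)] by (simp add: mult_right_mono)
  qed
  finally show ?thesis by (simp only: sq sum_distrib_left)
qed

lemma measure_pos: "0 < measure M D"
proof -
  have "0 < emeasure M D" using support_M D_nonempty unfolding full_support_def by auto
  then show ?thesis
    using finite_measure.emeasure_eq_measure[OF finite_M, of D] by simp
qed

text \<open>On an \<open>n\<close>-dimensional space of functions in the span of \<open>e 1, \<dots>, e (2 * n)\<close> that \<open>A\<close> annihilates,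
  the error bounds the reproducing kernel, whose integral over the diagonal is at least \<open>n * lam (2 * n)\<close>.\<close>

lemma finite_rank_error_ge:
  assumes A: "linear_map_on H A" "A ` H \<subseteq> cfun.span B" "finite B" "card B \<le> n" and n: "1 \<le> n"
  shows "ennreal (1 / sqrt (measure M D) * sqrt (real n * lam (2 * n)))
    \<le> (SUP f\<in>unit_ball H ip. sup_norm D (f - A f))" (is "_ \<le> ?E")
proof (cases "?E = \<infinity>")
  case False
  then obtain \<delta> where d: "0 \<le> \<delta>" "?E = ennreal \<delta>" by (metis ennreal_cases infinity_ennreal_def)
  have err: "cmod (f x - A f x) \<le> \<delta>" if "f \<in> unit_ball H ip" "x \<in> D" for f x
  proof -
    have "ennreal (cmod ((f - A f) x)) \<le> sup_norm D (f - A f)"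
      unfolding sup_norm_def by (rule SUP_upper[OF that(2)])
    also have "\<dots> \<le> ?E" by (rule SUP_upper[OF that(1)])
    finally show ?thesis using d by (simp add: ennreal_le_iff)
  qed
  obtain S where S: "orthonormal_set S" "card S = n" "S \<subseteq> cfun.span (eigenset (2 * n))" "\<And>v. v \<in> S \<Longrightarrow> A v = 0"
    using kernel_orthonormal_set[OF A, of n] by auto
  note SH = orthonormal_setD(3)[OF S(1)]
  have diag: "(\<Sum>v\<in>S. (cmod (v x))\<^sup>2) \<le> \<delta>\<^sup>2" if x: "x \<in> D" for x
  proof -
    let ?t = "\<Sum>v\<in>S. (cmod (v x))\<^sup>2"
    define a where "a = complex_of_real (1 / sqrt ?t)"
    \<comment> \<open>The normalized reproducing kernel of the span of \<open>S\<close> at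
      \<open>x\<close>: its value there is \<open>sqrt ?t\<close>, and since \<open>A\<close>
      annihilates it, the whole value is error.\<close>
    define f where "f = (\<Sum>v\<in>S. cscale (a * cnj (v x)) v)"
    have t0: "0 \<le> ?t" by (intro sum_nonneg) auto
    show ?thesis
    proof (cases "?t = 0")
      case False
      with t0 have t: "0 < ?t" by linarith
      have fH: "f \<in> H" unfolding f_def by (intro form.mem SH)
      have "sqn f = (\<Sum>v\<in>S. (cmod (a * cnj (v x)))\<^sup>2)" unfolding f_def by (rule sqn_combination[OF S(1)])
      also have "\<dots> = (cmod a)\<^sup>2 * ?t" by (simp add: norm_mult power_mult_distrib sum_distrib_left)
      also have "\<dots> = 1" using t by (simp add: a_def norm_divide power_divide)
      finally have fU: "f \<in> unit_ball H ip" using fH by (simp add: unit_ball_def ip_norm_def)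
      have "A f = (\<Sum>v\<in>S. cscale (a * cnj (v x)) (A v))"
        unfolding f_def by (rule linear_map_on_sum[OF A(1) subspace SH])
      also have "\<dots> = 0" by (rule sum.neutral) (simp add: S(4) cfun.scale_zero_right)
      finally have Af: "A f = 0" .
      have "f x = (\<Sum>v\<in>S. a * (v x * cnj (v x)))"
        unfolding f_def sum_fun_apply by (intro sum.cong refl) (simp only: cscale_apply mult_ac)
      also have "\<dots> = a * of_real ?t"
        by (simp only: complex_norm_square[symmetric] sum_distrib_left of_real_sum)
      finally have "cmod (f x) = cmod (a * of_real ?t)" by (rule arg_cong)
      also have "\<dots> = ?t / sqrt ?t"
        unfolding a_def of_real_mult[symmetric] norm_of_real using t by simp
      also have "\<dots> = sqrt ?t" by (rule real_div_sqrt[OF t0])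
      finally have "sqrt ?t \<le> \<delta>" using err[OF fU x] by (simp add: Af)
      then have "(sqrt ?t)\<^sup>2 \<le> \<delta>\<^sup>2" by (intro power_mono) (simp_all add: t0)
      then show ?thesis using t0 by simp
    qed simp
  qed
  interpret finite_measure M by (rule finite_M)
  have "real n * lam (2 * n) = (\<Sum>v\<in>S. lam (2 * n) * sqn v)"
    using S(2) orthonormal_setD(4)[OF S(1)] by simp
  also have "\<dots> \<le> (\<Sum>v\<in>S. Re (L2_ip M v v))"
    using S(3) n by (intro sum_mono L2_lower_bound) auto
  also have "\<dots> = (\<Sum>v\<in>S. \<integral>x. (cmod (v x))\<^sup>2 \<partial>M)"
    by (intro sum.cong refl) (simp add: L2_self(1)[OF SH])
  also have "\<dots> = (\<integral>x. (\<Sum>v\<in>S. (cmod (v x))\<^sup>2) \<partial>M)"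
    by (intro Bochner_Integration.integral_sum[symmetric] L2_self(2) SH)
  also have "\<dots> \<le> (\<integral>x. \<delta>\<^sup>2 \<partial>M)"
    using diag by (intro integral_mono Bochner_Integration.integrable_sum L2_self(2) SH) (auto simp: space_M)
  also have "\<dots> = \<delta>\<^sup>2 * measure M D" by (simp add: space_M)
  finally have "sqrt (real n * lam (2 * n)) \<le> sqrt (\<delta>\<^sup>2 * measure M D)" by (rule real_sqrt_le_mono)
  then have "sqrt (real n * lam (2 * n)) \<le> \<delta> * sqrt (measure M D)" using d(1) by (simp add: real_sqrt_mult)
  then have "1 / sqrt (measure M D) * sqrt (real n * lam (2 * n)) \<le> \<delta>"
    using measure_pos by (simp add: field_simps)
  then show ?thesis unfolding d(2) by (rule ennreal_leI)
next
  case True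
  show ?thesis unfolding True by simp
qed

lemma approx_number_ge:
  assumes "1 \<le> n"
  shows "ennreal (1 / sqrt (measure M D) * sqrt (real n * lam (2 * n))) \<le> approx_number D H ip n"
  unfolding approx_number_def
proof (rule INF_greatest)
  fix A assume "A \<in> {A. linear_map_on H A \<and> A ` H \<subseteq> l_infinity D \<and>
      (\<exists>C::real. \<forall>f\<in>H. sup_norm D (A f) \<le> ennreal (C * ip_norm ip f)) \<and> rank_less H A n}"
  then obtain B where B: "linear_map_on H A" "finite B" "card B < n" "cfun.span B = A ` H"
    unfolding rank_less_def by blast
  then show "ennreal (1 / sqrt (measure M D) * sqrt (real n * lam (2 * n)))
      \<le> (SUP f\<in>unit_ball H ip. sup_norm D (f - A f))"
    using assms by (intro finite_rank_error_ge[of A B]) auto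
qed

text \<open>Sampling followed by \<open>R\<close> factors through the \<open>n\<close>-tuples, so
  its image lies in the span of the at most \<open>n\<close> images of the unit tuples
  \<open>d k\<close>.\<close>

lemma sampling_number_ge:
  assumes "1 \<le> n"
  shows "ennreal (1 / sqrt (measure M D) * sqrt (real n * lam (2 * n))) \<le> sampling_number D H ip n"
  unfolding sampling_number_def
proof (rule INF_greatest, rule INF_greatest)
  fix x :: "nat \<Rightarrow> 'a" and R :: "(nat \<Rightarrow> complex) \<Rightarrow> 'a \<Rightarrow> complex"
  assume "R \<in> {R. linear_map_on (complex_tuples n) R \<and> R ` complex_tuples n \<subseteq> l_infinity D}"
  then have R: "linear_map_on (complex_tuples n) R" by blast
  define N where "N f = (\<lambda>i. if i < n then f (x i) else 0)" for f :: "'a \<Rightarrow> complex"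
  define d where "d k = (\<lambda>i::nat. if i = k then 1 else 0 :: complex)" for k
  have NT: "N f \<in> complex_tuples n" for f by (simp add: N_def complex_tuples_def)
  have dT: "d k \<in> complex_tuples n" if "k < n" for k using that by (auto simp: d_def complex_tuples_def)
  have sub: "cfun.subspace (complex_tuples n)"
    unfolding cfun.subspace_def complex_tuples_def by (auto simp: cscale_apply)
  have "N (f + g) = N f + N g" "N (cscale c f) = cscale c (N f)" for f g c
    by (auto simp: N_def fun_eq_iff cscale_apply)
  then have lin: "linear_map_on H (\<lambda>f. R (N f))"
    using R NT unfolding linear_map_on_def by simp
  have "R (N f) \<in> cfun.span ((\<lambda>k. R (d k)) ` {..<n})" for f
  proof -
    have "N f = (\<Sum>k<n. cscale (N f k) (d k))"
    proof
      fix i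
      have "(\<Sum>k<n. cscale (N f k) (d k)) i = (\<Sum>k<n. if k = i then N f k else 0)"
        unfolding sum_fun_apply by (intro sum.cong refl) (auto simp: cscale_apply d_def)
      also have "\<dots> = N f i" by (auto simp: N_def)
      finally show "N f i = (\<Sum>k<n. cscale (N f k) (d k)) i" by (rule sym)
    qed
    then have "R (N f) = R (\<Sum>k<n. cscale (N f k) (d k))" by (rule arg_cong)
    also have "\<dots> = (\<Sum>k<n. cscale (N f k) (R (d k)))"
      by (rule linear_map_on_sum[OF R sub dT]) simp
    also have "\<dots> \<in> cfun.span ((\<lambda>k. R (d k)) ` {..<n})"
      by (intro cfun.span_sum cfun.span_scale cfun.span_base) auto
    finally show ?thesis .
  qed
  then have "(\<lambda>f. R (N f)) ` H \<subseteq> cfun.span ((\<lambda>k. R (d k)) ` {..<n})" by blast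
  from finite_rank_error_ge[OF lin this _ _ assms]
  show "ennreal (1 / sqrt (measure M D) * sqrt (real n * lam (2 * n)))
      \<le> (SUP f\<in>unit_ball H ip. sup_norm D (f - R (\<lambda>i. if i < n then f (x i) else 0)))"
    using card_image_le[of "{..<n}" "\<lambda>k. R (d k)"] by (simp add: N_def)
qed

lemma optimal_orders_le:
  assumes "ereal p = (SUP p' \<in> {p'. sing_decay lam p'}. ereal p')"
  shows "q_std D H ip \<le> ereal (p - 1 / 2)" "q_lin D H ip \<le> ereal (p - 1 / 2)"
proof -
  have c: "0 < 1 / sqrt (measure M D)" using measure_pos by simp
  show "q_std D H ip \<le> ereal (p - 1 / 2)"
    unfolding q_std_def by (rule optimal_order_le[OF c sampling_number_ge lam_pos lam_antimono assms])
  show "q_lin D H ip \<le> ereal (p - 1 / 2)"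
    unfolding q_lin_def by (rule optimal_order_le[OF c approx_number_ge lam_pos lam_antimono assms])
qed

end

theorem corollary6p1:
  fixes D :: "(real ^ 'd) set"
    and K :: "real ^ 'd \<Rightarrow> real ^ 'd \<Rightarrow> complex"
    and H :: "(real ^ 'd \<Rightarrow> complex) set"
    and ip :: "(real ^ 'd \<Rightarrow> complex) \<Rightarrow> (real ^ 'd \<Rightarrow> complex) \<Rightarrow> complex"
    and \<rho> :: "(real ^ 'd) measure"
    and lam :: "nat \<Rightarrow> real" and e :: "nat \<Rightarrow> real ^ 'd \<Rightarrow> complex"
    and p :: real
  assumes "compact D"
    and "continuous_on (D \<times> D) (\<lambda>(x, y). K x y)"
    and "hermitian_pos_def_kernel D K"
    and "bdd_above ((\<lambda>x. sqrt (Re (K x x))) ` D)"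
    and "rkhs D K H ip"
    and "infinite_dimensional H"
    and "finite_borel_measure_on D \<rho>"
    and "full_support D \<rho>"
    and "spectral_data H ip \<rho> lam e"
    and "p > 1 / 2"
    and "sing_decay lam p"
    and "ereal p = (SUP p' \<in> {p'. sing_decay lam p'}. ereal p')"
  shows "(\<forall>u::real. spectral_growth D lam e u \<longrightarrow>
            ereal u = (INF u' \<in> {u'. spectral_growth D lam e u'}. ereal u') \<longrightarrow>
            2 * p > u \<longrightarrow>
            q_std D H ip \<ge> ereal (p - u / 2) \<and>
            (u = 1 \<longrightarrow> q_std D H ip = q_lin D H ip \<and> q_lin D H ip = ereal (p - 1 / 2)))
       \<and> ((\<exists>C\<^sub>1>0. \<forall>j\<ge>1. sup_norm D (eta lam e j) \<le> ennreal C\<^sub>1) \<longrightarrow>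
            q_std D H ip = q_lin D H ip \<and> q_lin D H ip = ereal (p - 1 / 2))"
proof -
  interpret rkhs D K H ip by fact
  interpret spectral_rkhs D K H ip \<rho> lam e
    by unfold_locales fact+
  \<comment> \<open>Condition (i') and the case \<open>u = 1\<close> both reduce to growth exponent
    1. Then \<open>p > 1 / 2\<close> is exactly the requirement \<open>u < 2 * p\<close>, and the
    bounds from both sides meet.\<close>
  have both: "q_std D H ip = q_lin D H ip \<and> q_lin D H ip = ereal (p - 1 / 2)"
    if "spectral_growth D lam e 1"
    using optimal_orders_ge_spectral[OF \<open>sing_decay lam p\<close> that] optimal_orders_le[OF assms(12)] \<open>p > 1 / 2\<close>
    by (auto intro: antisym)
  show ?thesis
  proof (intro conjI allI impI)
    fix u :: real
    assume "spectral_growth D lam e u" "2 * p > u"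
    then show "ereal (p - u / 2) \<le> q_std D H ip"
      by (intro optimal_orders_ge_spectral(1)[OF \<open>sing_decay lam p\<close>])
  qed (use both spectral_growth_bounded_eta in blast)+
qed

end
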